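(* Let $p$ be an odd prime. If $p\equiv 1,3\pmod 8$ and $x,y$ are integers with $p=x^2+2y^2$ (such integers exist), then $$\sum_{k=0}^{p-1}\binom{2k}{k}\frac{a_k}{4^k}\equiv 4x^2\pmod p.$$ If $p\equiv 5,7\pmod 8$, then $$\sum_{k=0}^{p-1}\binom{2k}{k}\frac{a_k}{4^k}\equiv 0\pmod p.$$
   Context: For nonnegative integers $n$, $a_n=\sum_{k=0}^n\binom{n}{k}^2\binom{2k}{k}$. Congruences modulo $p$ are taken in the ring of rational numbers whose denominator is not divisible by $p$. *)

theory Defs
  imports "HOL-Number_Theory.Number_Theory"
begin

definition a_seq :: "nat \<Rightarrow> nat" where
  "a_seq n = (\<Sum>k\<le>n. (n choose k)^2 * ((2 * k) choose k))"

text \<open>The ring of rational numbers whose denominator (in lowest terms) is not divisible by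
  \<open>p\<close>; \<^const>\<open>quotient_of\<close> returns the reduced fraction with positive denominator.\<close>

definition p_integral_rats :: "nat \<Rightarrow> rat set" where
  "p_integral_rats p = {r. \<not> int p dvd snd (quotient_of r)}"

text \<open>Congruence modulo \<open>p\<close> in that ring: both sides belong to the ring, and their difference
  lies in the ideal generated by \<open>p\<close>. (Divisibility in the field \<^typ>\<open>rat\<close> would be trivial.)\<close>

definition rat_cong :: "nat \<Rightarrow> rat \<Rightarrow> rat \<Rightarrow> bool" where
  "rat_cong p r s \<longleftrightarrow>
     r \<in> p_integral_rats p \<and> s \<in> p_integral_rats p \<and>
     (\<exists>t \<in> p_integral_rats p. r - s = of_nat p * t)"

end

theory Submission
  imports Defs
begin

text \<open>Write \<open>p = 2 * m + 1\<close>. Modulo \<open>p\<close> the number \<open>-1/2\<close> is \<open>m\<close>, so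
\<open>(2k choose k) / (-4)^k\<close>, which is the binomial coefficient of \<open>-1/2\<close> over \<open>k\<close>, is congruent to
\<open>m choose k\<close> (\<open>central_binomial_cong_half\<close>). The sum of the theorem therefore becomes an alternating
binomial sum of \<open>a\<^sub>k\<close>, that is, an iterated finite difference, and finite differences of binomial
coefficients collapse. What remains is, after the same congruence has been used again, a truncated
hypergeometric series with parameters \<open>1/4, 3/4, 1/2; 1, 1\<close> at the argument \<open>1\<close>. With
\<open>N = p div 4\<close> the parameters \<open>1/4\<close> and \<open>3/4\<close> are congruent to \<open>-N\<close> and \<open>N + 1\<close> in some order, so the
series terminates; it is a moment of the Legendre polynomial of degree \<open>N\<close> and has a closed form by
Watson's theorem, proved here by telescoping (\<open>legendre_moment_step\<close>). It vanishes for odd \<open>N\<close>, which is the case \<open>p \<equiv> 5, 7 (mod 8)\<close>, and for even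
\<open>N\<close> it gives \<open>(m choose (p div 8))^2\<close> modulo \<open>p\<close> (\<open>sum_cong_binomial_square\<close>).

For \<open>p \<equiv> 1, 3 (mod 8)\<close> it remains to prove \<open>4 * a^2 \<equiv> (m choose (p div 8))^2\<close> for
\<open>p = a^2 + 2 * b^2\<close>. This is an evaluation of a character sum \<open>E\<close> that lies in
\<open>\<int>[\<surd>-2]\<close>. Take a character \<open>\<chi>\<close> of order eight on a commutative algebra of dimension
two over the field with \<open>p\<close> elements, such that the conjugation of the algebra turns \<open>\<chi>\<close> into
\<open>\<chi>^3\<close>, and sum \<open>\<chi>\<close> over an affine line. The algebra is a product of two copies of the prime field
for \<open>p \<equiv> 1\<close>, where \<open>E\<close> is a Jacobi sum, and the field of Gaussian integers modulo \<open>p\<close> for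
\<open>p \<equiv> 3\<close>, where \<open>E\<close> is an Eisenstein sum. Three facts are proved in each case. The conjugation
symmetry makes the sum of \<open>\<chi>^3\<close> equal to \<open>E\<close>, and \<open>\<zeta> + \<zeta>^3 = \<surd>-2\<close> for a primitive eighth root
of unity \<open>\<zeta>\<close>, so \<open>E = a + b * \<surd>-2\<close>. The norm of \<open>E\<close> is \<open>p\<close>, so \<open>p = a^2 + 2 * b^2\<close>; in particular
the representation exists. Finally \<open>\<chi>\<close> is congruent to a power map modulo a prime above \<open>p\<close>, so the
trace \<open>2 * a\<close> is congruent to a power sum, and this is a binomial coefficient up to sign
(\<open>split_norm_form\<close>, \<open>inert_norm_form\<close>). Any other representation has the same square \<open>x^2\<close>
(\<open>norm_form_unique\<close>).\<close>


section \<open>Central binomial coefficients and finite differences\<close>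

lemma central_binomial_step:
  "int (Suc k) * int ((2 * Suc k) choose Suc k) = 2 * (2 * int k + 1) * int ((2 * k) choose k)"
proof -
  have 1: "Suc k * ((2 * Suc k) choose Suc k) = (2 * Suc k) * (Suc (2 * k) choose k)"
    using Suc_times_binomial_eq[of "Suc (2*k)" k] by (simp add: mult.commute)
  have 2: "Suc k * (Suc (2 * k) choose k) = Suc (2 * k) * ((2 * k) choose k)"
    using binomial_absorb_comp[of "Suc (2*k)" k] by simp
  have "Suc k * (Suc k * ((2 * Suc k) choose Suc k)) = Suc k * (2 * Suc (2 * k) * ((2 * k) choose k))"
    unfolding 1 using 2 by (metis mult.assoc mult.left_commute)
  then have "Suc k * ((2 * Suc k) choose Suc k) = 2 * Suc (2 * k) * ((2 * k) choose k)"
    by (metis mult_cancel1 nat.distinct(1))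
  then have "int (Suc k * ((2 * Suc k) choose Suc k)) = int (2 * Suc (2 * k) * ((2 * k) choose k))"
    by (rule arg_cong)
  then show ?thesis by (simp only: of_nat_mult) (simp add: algebra_simps)
qed

lemma binomial_step: "int (Suc k) * int (n choose Suc k) = (int n - int k) * int (n choose k)"
proof (cases "k \<le> n")
  case True
  then have "int (n - k) * int (n choose k) = int (Suc k) * int (n choose Suc k)"
    using binomial_absorb_comp[of n k] binomial_absorption[of k n] by (metis of_nat_mult)
  then show ?thesis using True by (simp add: of_nat_diff)
next
  case False
  then show ?thesis by (simp add: binomial_eq_0)
qed

lemma cong_cancel_Suc:
  fixes p k :: nat and a b :: int
  assumes "prime p" "Suc k < p" "[int (Suc k) * a = int (Suc k) * b] (mod int p)"
  shows "[a = b] (mod int p)"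
proof -
  have "coprime (int (Suc k)) (int p)"
    using assms(1,2) by (metis coprime_commute coprime_int_iff nat_dvd_not_less prime_imp_coprime zero_less_Suc)
  with assms(3) show ?thesis by (metis cong_mult_lcancel)
qed

lemma cong_cancel_Suc2:
  fixes p k :: nat and a b :: int
  assumes "prime p" "Suc k < p" "[int (Suc k) ^ 2 * a = int (Suc k) ^ 2 * b] (mod int p)"
  shows "[a = b] (mod int p)"
  using assms cong_cancel_Suc[OF assms(1,2)] by (simp add: power2_eq_square mult.assoc)

text \<open>With \<open>h = 1/4\<close>: the ratio of consecutive terms is \<open>(2k + 1) / (2 (k + 1))\<close> on the left and
\<open>-(m - k) / (k + 1)\<close> on the right, and \<open>2 * m + 1 = p\<close> makes the two congruent. For
\<open>m < k < p\<close> both sides are zero modulo \<open>p\<close>.\<close>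

lemma central_binomial_cong_half:
  fixes p m k :: nat and h :: int
  assumes p: "prime p" and m: "p = 2 * m + 1" and h: "[4 * h = 1] (mod int p)" and "k < p"
  shows "[int ((2 * k) choose k) * h ^ k = (-1) ^ k * int (m choose k)] (mod int p)"
  using \<open>k < p\<close>
proof (induction k)
  case 0
  then show ?case by simp
next
  case (Suc k)
  let ?P = "int p"
  have IH: "[int ((2 * k) choose k) * h ^ k = (-1) ^ k * int (m choose k)] (mod ?P)"
    using Suc by simp
  have coef: "[2 * (2 * int k + 1) * h = - (int m - int k)] (mod ?P)"
  proof -
    have "[2 * (2 * int k + 1) * h = (2 * (2 * int k + 1) - 2 * ?P) * h] (mod ?P)"
      by (simp add: cong_iff_dvd_diff algebra_simps)
    also have "(2 * (2 * int k + 1) - 2 * ?P) * h = - (int m - int k) * (4 * h)"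
      using m by (simp add: algebra_simps)
    also have "[- (int m - int k) * (4 * h) = - (int m - int k) * 1] (mod ?P)"
      by (rule cong_scalar_left[OF h])
    finally show ?thesis by simp
  qed
  have "int (Suc k) * (int ((2 * Suc k) choose Suc k) * h ^ Suc k)
        = (2 * (2 * int k + 1) * h) * (int ((2 * k) choose k) * h ^ k)"
    using central_binomial_step[of k] by (simp only: mult.assoc[symmetric]) (simp add: algebra_simps)
  also have "[\<dots> = - (int m - int k) * ((-1) ^ k * int (m choose k))] (mod ?P)"
    by (rule cong_mult[OF coef IH])
  also have "- (int m - int k) * ((-1) ^ k * int (m choose k))
        = int (Suc k) * ((-1) ^ Suc k * int (m choose Suc k))"
    using binomial_step[of k m] by (metis (no_types, lifting) minus_mult_commute mult.left_commute mult_minus_left power_Suc mult_1)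
  finally show ?case using cong_cancel_Suc p Suc.prems by blast
qed

lemma alternating_sum_Suc:
  fixes f :: "nat \<Rightarrow> int"
  shows "(\<Sum>i\<le>Suc M. (-1) ^ i * int (Suc M choose i) * f i)
       = (\<Sum>i\<le>M. (-1) ^ i * int (M choose i) * (f i - f (Suc i)))"
proof -
  have "(\<Sum>i\<le>Suc M. (-1) ^ i * int (Suc M choose i) * f i)
      = f 0 + (\<Sum>i\<le>M. (-1) ^ Suc i * int (Suc M choose Suc i) * f (Suc i))"
    by (simp add: sum.atMost_Suc_shift del: binomial_Suc_Suc sum.atMost_Suc)
  also have "\<dots> = f 0 + (\<Sum>i\<le>M. (-1) ^ Suc i * int (M choose Suc i) * f (Suc i))
                 - (\<Sum>i\<le>M. (-1) ^ i * int (M choose i) * f (Suc i))"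
    by (simp add: sum.distrib[symmetric] sum_subtractf[symmetric] algebra_simps sum_negf)
  also have "f 0 + (\<Sum>i\<le>M. (-1) ^ Suc i * int (M choose Suc i) * f (Suc i))
      = (\<Sum>i\<le>Suc M. (-1) ^ i * int (M choose i) * f i)"
    by (simp add: sum.atMost_Suc_shift del: sum.atMost_Suc)
  also have "\<dots> = (\<Sum>i\<le>M. (-1) ^ i * int (M choose i) * f i)" by simp
  finally show ?thesis by (simp add: sum_subtractf[symmetric] algebra_simps)
qed

text \<open>The \<open>M\<close>-th finite difference of \<open>a \<mapsto> a choose j\<close>, up to sign: each difference lowers \<open>j\<close> by one.\<close>

lemma finite_difference_binomial:
  "(\<Sum>i\<le>M. (-1) ^ i * int (M choose i) * int ((i + a) choose j))
    = (-1) ^ M * (if M \<le> j then int (a choose (j - M)) else 0)"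
proof (induction M arbitrary: j)
  case 0
  then show ?case by simp
next
  case (Suc M)
  show ?case
  proof (cases j)
    case 0
    then show ?thesis unfolding alternating_sum_Suc by simp
  next
    case (Suc l)
    have "int ((i + a) choose j) - int ((Suc i + a) choose j) = - int ((i + a) choose l)" for i
      using Suc by simp
    then show ?thesis unfolding alternating_sum_Suc
      using Suc.IH[of l] Suc by (simp add: sum_negf)
  qed
qed

text \<open>Since \<open>(m choose k) (k choose j) = (m choose j) ((m - j) choose (k - j))\<close>, one of the two factors
\<open>k choose j\<close> is absorbed and an \<open>(m - j)\<close>-th finite difference of the other one is left.\<close>

lemma alternating_sum_binomial_squares:
  assumes "j \<le> m"
  shows "(\<Sum>k\<le>m. (-1) ^ k * int (m choose k) * int (k choose j) ^ 2)
       = (-1) ^ m * int (m choose j) * int (j choose (m - j))"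
proof -
  have "(\<Sum>k\<le>m. (-1) ^ k * int (m choose k) * int (k choose j) ^ 2)
      = (\<Sum>k=j..m. (-1) ^ k * int (m choose k) * int (k choose j) ^ 2)"
    by (rule sum.mono_neutral_right) (auto simp: not_le)
  also have "\<dots> = (\<Sum>i\<le>m - j. (-1) ^ (i + j) * int (m choose (i + j)) * int ((i + j) choose j) ^ 2)"
    by (rule sum.reindex_bij_witness[of _ "\<lambda>i. i + j" "\<lambda>k. k - j"]) (use assms in auto)
  also have "\<dots> = (\<Sum>i\<le>m - j. (-1) ^ j * int (m choose j) *
                    ((-1) ^ i * int ((m - j) choose i) * int ((i + j) choose j)))"
  proof (rule sum.cong[OF refl])
    fix i assume "i \<in> {..m - j}"
    then have "(m choose (i + j)) * ((i + j) choose j) = (m choose j) * ((m - j) choose i)"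
      using choose_mult[of j "i + j" m] assms by simp
    then have "int (m choose (i + j)) * int ((i + j) choose j) = int (m choose j) * int ((m - j) choose i)"
      by (metis of_nat_mult)
    then show "(-1) ^ (i + j) * int (m choose (i + j)) * int ((i + j) choose j) ^ 2 =
        (-1) ^ j * int (m choose j) * ((-1) ^ i * int ((m - j) choose i) * int ((i + j) choose j))"
      by (simp add: power2_eq_square power_add)
  qed
  also have "\<dots> = (-1) ^ j * int (m choose j) * ((-1) ^ (m - j) *
                    (if m - j \<le> j then int (j choose (j - (m - j))) else 0))"
    unfolding sum_distrib_left[symmetric] finite_difference_binomial ..
  also have "(if m - j \<le> j then int (j choose (j - (m - j))) else 0) = int (j choose (m - j))"
    using binomial_symmetric[of "m - j" j] by (auto simp: binomial_eq_0)
  also have "(-1) ^ j * int (m choose j) * ((-1) ^ (m - j) * int (j choose (m - j)))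
      = (-1) ^ (j + (m - j)) * int (m choose j) * int (j choose (m - j))"
    by (simp add: power_add)
  finally show ?thesis using assms by simp
qed

lemma alternating_sum_a_seq:
  "(\<Sum>k\<le>m. (-1) ^ k * int (m choose k) * int (a_seq k))
    = (-1) ^ m * (\<Sum>j\<le>m. int (m choose j) * int (j choose (m - j)) * int ((2 * j) choose j))"
proof -
  have a: "int (a_seq k) = (\<Sum>j\<le>m. int (k choose j) ^ 2 * int ((2 * j) choose j))" if "k \<le> m" for k
    unfolding a_seq_def of_nat_sum
    by (rule sum.mono_neutral_cong_left) (use that in \<open>auto simp: not_le\<close>)
  have "(\<Sum>k\<le>m. (-1) ^ k * int (m choose k) * int (a_seq k))
      = (\<Sum>k\<le>m. \<Sum>j\<le>m. (-1) ^ k * int (m choose k) * (int (k choose j) ^ 2 * int ((2 * j) choose j)))"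
    by (rule sum.cong[OF refl]) (simp add: a sum_distrib_left)
  also have "\<dots> = (\<Sum>j\<le>m. int ((2 * j) choose j) *
                     (\<Sum>k\<le>m. (-1) ^ k * int (m choose k) * int (k choose j) ^ 2))"
    by (subst sum.swap) (simp add: sum_distrib_left algebra_simps)
  also have "\<dots> = (\<Sum>j\<le>m. int ((2 * j) choose j) * ((-1) ^ m * int (m choose j) * int (j choose (m - j))))"
    by (rule sum.cong[OF refl]) (simp add: alternating_sum_binomial_squares)
  finally show ?thesis by (simp add: sum_distrib_left algebra_simps)
qed

section \<open>A moment of the Legendre polynomial\<close>

text \<open>The mean of the Legendre polynomial
\<open>P\<^sub>N (1 - 2 x) = (\<Sum>i\<le>N. (N choose i) ((N + i) choose i) (-x)^i)\<close> under the arcsine distribution on the unit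
interval, whose \<open>i\<close>-th moment is \<open>(2i choose i) / 4^i\<close>.\<close>

definition legendre_moment :: "nat \<Rightarrow> real" where
  "legendre_moment N = (\<Sum>i\<le>N. real (N choose i) * real ((N + i) choose i) *
                           (real ((2 * i) choose i) * (-1/4) ^ i))"

lemma central_binomial_quarter_step:
  "(real i + 1) * (real ((2 * Suc i) choose Suc i) * (-1/4) ^ Suc i)
    = - (2 * real i + 1) / 2 * (real ((2 * i) choose i) * (-1/4) ^ i)"
proof -
  have "(real i + 1) * real ((2 * Suc i) choose Suc i) = 2 * (2 * real i + 1) * real ((2 * i) choose i)"
    using arg_cong[OF central_binomial_step[of i], of real_of_int] by (simp add: algebra_simps)
  note step = this
  have "(real i + 1) * (real ((2 * Suc i) choose Suc i) * (-1/4) ^ Suc i)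
      = ((real i + 1) * real ((2 * Suc i) choose Suc i)) * ((-1/4) * (-1/4) ^ i)"
    by (simp only: power_Suc mult.assoc)
  then show ?thesis unfolding step by (simp add: algebra_simps del: binomial_Suc_Suc mult_Suc_right)
qed

lemma legendre_coeff_fact:
  assumes "i \<le> N"
  shows "real (N choose i) * real ((N + i) choose i) = fact (N + i) / (fact i ^ 2 * fact (N - i))"
  using assms by (simp add: binomial_fact power2_eq_square)

text \<open>Creative telescoping in the manner of Zeilberger. Both \<open>(N choose i) ((N + i) choose i)\<close> and the same
expression for \<open>N + 2\<close> are polynomial multiples of the common factor \<open>W i\<close>, so the recurrence
reduces to the polynomial identity \<open>cert\<close>. The certificate is \<open>G\<close>. The boundary terms vanish
because \<open>G 0 = 0\<close> and because \<open>n + 2 - i\<close> is zero at \<open>i = N + 2\<close>.\<close>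

lemma legendre_moment_step:
  "(real N + 2) ^ 2 * legendre_moment (N + 2) = (real N + 1) ^ 2 * legendre_moment N"
proof -
  define n where "n = real N"
  define b where "b i = real ((2 * i) choose i) * (-1/4) ^ i" for i
  define W :: "nat \<Rightarrow> real" where "W i = fact (N + i) / (fact i ^ 2 * fact (N + 2 - i))" for i
  define G where "G i = - 2 * (2 * n + 3) * real i ^ 3 * W i * b i" for i
  have lo: "real (N choose i) * real ((N + i) choose i) = W i * (n + 1 - real i) * (n + 2 - real i)"
    if "i \<le> N + 2" for i
  proof (cases "i \<le> N")
    case True
    then obtain d where d: "N = i + d" using le_Suc_ex by blast
    have f: "fact (N + 2 - i) = (n + 2 - real i) * (n + 1 - real i) * fact (N - i)"
      unfolding n_def d by (simp add: numeral_2_eq_2 algebra_simps)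
    have nz: "n + 2 - real i \<noteq> 0" "n + 1 - real i \<noteq> 0"
      using True by (simp_all add: n_def)
    have "W i * (n + 1 - real i) * (n + 2 - real i)
        = fact (N + i) * ((n + 2 - real i) * (n + 1 - real i))
            / (fact i ^ 2 * fact (N - i) * ((n + 2 - real i) * (n + 1 - real i)))"
      unfolding W_def f by (simp add: mult_ac)
    then show ?thesis unfolding legendre_coeff_fact[OF True] using nz by simp
  next
    case False
    then have "i = N + 1 \<or> i = N + 2" using that by linarith
    then show ?thesis by (auto simp: n_def binomial_eq_0)
  qed
  have hi: "real ((N + 2) choose i) * real ((N + 2 + i) choose i) = W i * (n + 1 + real i) * (n + 2 + real i)"
    if "i \<le> N + 2" for i
  proof -
    have "fact (N + 2 + i) = fact (N + i) * (n + 1 + real i) * (n + 2 + real i)"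
      unfolding n_def by (simp add: numeral_2_eq_2 mult_ac add_ac)
    then show ?thesis unfolding legendre_coeff_fact[OF that] W_def by simp
  qed
  have Wstep: "(real i + 1) ^ 2 * W (Suc i) = W i * (n + 1 + real i) * (n + 2 - real i)"
    if "i < N + 2" for i
  proof -
    define d where "d = N + 2 - Suc i"
    have d: "N + 2 - i = Suc d" "N + 2 - Suc i = d" "n + 2 - real i = real (Suc d)"
      using that by (simp_all add: d_def n_def)
    have "(real i + 1) ^ 2 * W (Suc i)
        = (real i + 1) ^ 2 * ((n + 1 + real i) * fact (N + i)) / ((real i + 1) ^ 2 * (fact i ^ 2 * fact d))"
      unfolding W_def d n_def by (simp add: power_mult_distrib add_ac)
    also have "\<dots> = (n + 1 + real i) * fact (N + i) / (fact i ^ 2 * fact d)"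
      by (rule mult_divide_mult_cancel_left) simp
    also have "\<dots> = W i * (n + 1 + real i) * (n + 2 - real i)"
      unfolding W_def d by simp
    finally show ?thesis .
  qed
  define D where "D i = (n + 2) ^ 2 * (W i * (n + 1 + real i) * (n + 2 + real i) * b i)
      - (n + 1) ^ 2 * (W i * (n + 1 - real i) * (n + 2 - real i) * b i)" for i
  have cert: "D i = (2 * n + 3) * (2 * real i + 1) * (W i * (n + 1 + real i) * (n + 2 - real i)) * b i - G i" for i
    unfolding D_def G_def by (simp add: power2_eq_square power3_eq_cube algebra_simps)
  have tele: "D i = G (Suc i) - G i" if "i < N + 2" for i
  proof -
    have "G (Suc i) = - 2 * (2 * n + 3) * ((real i + 1) ^ 2 * W (Suc i)) * ((real i + 1) * b (Suc i))"
      unfolding G_def by (simp add: power2_eq_square power3_eq_cube algebra_simps)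
    also have "\<dots> = (2 * n + 3) * (2 * real i + 1) * (W i * (n + 1 + real i) * (n + 2 - real i)) * b i"
    proof -
      have "- 2 * c * A * (- y / 2 * B) = c * y * A * B" for A B c y :: real by simp
      then show ?thesis unfolding Wstep[OF that] b_def central_binomial_quarter_step .
    qed
    finally show ?thesis by (simp add: cert)
  qed
  have "(\<Sum>i\<le>N + 2. D i) = (\<Sum>i<N + 2. D i) + D (N + 2)"
    by (metis lessThan_Suc_atMost sum.lessThan_Suc)
  also have "(\<Sum>i<N + 2. D i) = (\<Sum>i<N + 2. G (Suc i) - G i)"
    by (rule sum.cong) (auto simp: tele)
  also have "\<dots> = G (N + 2) - G 0" by (rule sum_lessThan_telescope)
  also have "G 0 = 0" by (simp add: G_def)
  also have "D (N + 2) = - G (N + 2)" unfolding cert by (simp add: n_def)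
  finally have zero: "(\<Sum>i\<le>N + 2. D i) = 0" by simp
  have "legendre_moment N = (\<Sum>i\<le>N + 2. real (N choose i) * real ((N + i) choose i) * b i)"
    unfolding legendre_moment_def b_def by (rule sum.mono_neutral_left) (auto simp: binomial_eq_0)
  also have "\<dots> = (\<Sum>i\<le>N + 2. W i * (n + 1 - real i) * (n + 2 - real i) * b i)"
    by (rule sum.cong) (simp_all add: lo)
  finally have m1: "legendre_moment N = \<dots>" .
  have "legendre_moment (N + 2) = (\<Sum>i\<le>N + 2. W i * (n + 1 + real i) * (n + 2 + real i) * b i)"
    unfolding legendre_moment_def b_def[symmetric] by (rule sum.cong[OF refl]) (simp only: hi atMost_iff)
  with m1 zero show ?thesis
    by (simp add: D_def sum_subtractf sum_distrib_left[symmetric] n_def del: sum.atMost_Suc)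
qed

lemma legendre_moment_closed:
  "legendre_moment (2 * n) = (real ((2 * n) choose n) / 4 ^ n) ^ 2 \<and> legendre_moment (2 * n + 1) = 0"
proof (induction n)
  case 0
  then show ?case by (simp add: legendre_moment_def)
next
  case (Suc n)
  have "2 * (2 * real n + 1) * real ((2 * n) choose n) = (real n + 1) * real ((2 * Suc n) choose Suc n)"
    using arg_cong[OF central_binomial_step[of n], of real_of_int] by (simp add: algebra_simps)
  then have c: "real ((2 * n) choose n) = (real n + 1) * real ((2 * Suc n) choose Suc n) / (2 * (2 * real n + 1))"
    by (simp add: field_simps)
  have "(2 * real n + 2) ^ 2 * legendre_moment (2 * Suc n) = (2 * real n + 1) ^ 2 * (real ((2 * n) choose n) / 4 ^ n) ^ 2"
    using legendre_moment_step[of "2 * n"] Suc by simp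
  also have "\<dots> = (2 * real n + 2) ^ 2 * (real ((2 * Suc n) choose Suc n) / 4 ^ Suc n) ^ 2"
  proof -
    have "(2 * r + 1) ^ 2 * ((r + 1) * X / (2 * (2 * r + 1)) / Y) ^ 2 = (2 * r + 2) ^ 2 * (X / (4 * Y)) ^ 2"
      if "2 * r + 1 \<noteq> 0" for r X Y :: real
    proof -
      have "(2 * r + 1) * ((r + 1) * X / (2 * (2 * r + 1)) / Y) = (2 * r + 2) * (X / (4 * Y))"
      proof -
        have "d * (Z / (2 * d) / Y) = Z / 2 / Y" if "d \<noteq> 0" for d Z :: real using that by simp
        moreover have "(2 * r + 2) * (X / (4 * Y)) = (r + 1) * X / 2 / Y"
          by (cases "Y = 0") (simp_all add: field_simps)
        ultimately show ?thesis using that by metis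
      qed
      then show ?thesis by (simp only: power_mult_distrib[symmetric])
    qed
    then show ?thesis unfolding c power_Suc by simp
  qed
  finally have "legendre_moment (2 * Suc n) = (real ((2 * Suc n) choose Suc n) / 4 ^ Suc n) ^ 2"
    by (simp only: mult_cancel_left power_eq_0_iff) (use of_nat_0_le_iff[of n] in linarith)
  moreover have "legendre_moment (2 * Suc n + 1) = 0"
    using legendre_moment_step[of "2 * n + 1"] Suc by (simp add: add.commute)
  ultimately show ?case by blast
qed

text \<open>The closed form cleared of denominators by the factor \<open>4^N\<close>, for use in congruences.\<close>

lemma legendre_moment_int:
  "(\<Sum>i\<le>N. int (N choose i) * int ((N + i) choose i) * (int ((2 * i) choose i) * ((-1) ^ i * 4 ^ (N - i))))
    = (if even N then int (N choose (N div 2)) ^ 2 else 0)"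
proof -
  have q: "(-1/4 :: real) ^ i * 4 ^ N = (-1) ^ i * 4 ^ (N - i)" if "i \<le> N" for i
  proof -
    have "(4::real) ^ N = 4 ^ i * 4 ^ (N - i)" using that by (simp flip: power_add)
    moreover have "(-1/4 :: real) ^ i * 4 ^ i = (-1) ^ i" by (simp flip: power_mult_distrib)
    ultimately show ?thesis by (metis mult.assoc)
  qed
  have "of_int (\<Sum>i\<le>N. int (N choose i) * int ((N + i) choose i) * (int ((2 * i) choose i) * ((-1) ^ i * 4 ^ (N - i))))
      = (\<Sum>i\<le>N. real (N choose i) * real ((N + i) choose i) * (real ((2 * i) choose i) * ((-1/4) ^ i * 4 ^ N)))"
    unfolding of_int_sum by (rule sum.cong[OF refl]) (simp add: q[simplified])
  also have "\<dots> = legendre_moment N * 4 ^ N"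
    unfolding legendre_moment_def sum_distrib_right by (simp add: mult.assoc)
  also have "\<dots> = of_int (if even N then int (N choose (N div 2)) ^ 2 else 0)"
  proof (cases "even N")
    case True
    then obtain n where "N = 2 * n" by blast
    then show ?thesis using legendre_moment_closed[of n]
      by (simp add: power_divide power_mult power2_eq_square flip: power_mult_distrib)
  next
    case False
    then obtain n where "N = 2 * n + 1" using oddE by blast
    then show ?thesis using legendre_moment_closed[of n] by simp
  qed
  finally show ?thesis by (simp only: of_int_eq_iff)
qed

section \<open>The sum as the square of a binomial coefficient\<close>

lemma half_binomial_step:
  "int (Suc i) ^ 2 * (int (m choose (2 * Suc i)) * int ((2 * Suc i) choose Suc i))
    = (int m - 2 * int i) * (int m - 2 * int i - 1) * (int (m choose (2 * i)) * int ((2 * i) choose i))"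
proof -
  have 1: "int (Suc (2 * i)) * int (m choose Suc (2 * i)) = (int m - 2 * int i) * int (m choose (2 * i))"
    using binomial_step[of "2 * i" m] by simp
  have 2: "int (2 * Suc i) * int (m choose (2 * Suc i)) = (int m - 2 * int i - 1) * int (m choose Suc (2 * i))"
    using binomial_step[of "Suc (2 * i)" m] by simp
  let ?c = "int (2 * Suc (2 * i))"
  have "?c * (int (Suc i) ^ 2 * (int (m choose (2 * Suc i)) * int ((2 * Suc i) choose Suc i)))
     = int (Suc (2 * i)) * (int (2 * Suc i) * int (m choose (2 * Suc i))) * (int (Suc i) * int ((2 * Suc i) choose Suc i))"
    by (simp only: of_nat_mult power2_eq_square) (simp add: algebra_simps del: binomial_Suc_Suc mult_Suc_right mult_Suc of_nat_Suc)
  also have "\<dots> = (int m - 2 * int i - 1) * (int (Suc (2 * i)) * int (m choose Suc (2 * i))) * (int (Suc i) * int ((2 * Suc i) choose Suc i))"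
    unfolding 2 by (simp only: ac_simps)
  also have "\<dots> = ?c * ((int m - 2 * int i) * (int m - 2 * int i - 1) * (int (m choose (2 * i)) * int ((2 * i) choose i)))"
    unfolding 1 central_binomial_step by (simp add: algebra_simps)
  finally show ?thesis by (simp only: mult_cancel_left) simp
qed

lemma legendre_binomial_step:
  "int (Suc i) ^ 2 * (int (N choose Suc i) * int ((N + Suc i) choose Suc i))
    = (int N - int i) * (int N + int i + 1) * (int (N choose i) * int ((N + i) choose i))"
proof -
  have 1: "int (Suc i) * int ((N + Suc i) choose Suc i) = (int N + int i + 1) * int ((N + i) choose i)"
    using arg_cong[OF Suc_times_binomial_eq[of "N + i" i], of int]
    by (simp only: of_nat_mult add_Suc_right) (simp add: algebra_simps)
  have "int (Suc i) ^ 2 * (int (N choose Suc i) * int ((N + Suc i) choose Suc i))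
     = (int (Suc i) * int (N choose Suc i)) * (int (Suc i) * int ((N + Suc i) choose Suc i))"
    by (simp only: power2_eq_square ac_simps)
  then show ?thesis unfolding 1 binomial_step[of i N] by (simp only: ac_simps)
qed

text \<open>Both sides satisfy a recurrence of order one in \<open>i\<close>, and the coefficients agree modulo \<open>p\<close>: with
\<open>m \<equiv> -1/2\<close>, and \<open>N \<equiv> -1/4\<close> or \<open>N \<equiv> -3/4\<close>, both
\<open>-(m - 2i) (m - 2i - 1)\<close> and \<open>4 (N - i) (N + i + 1)\<close> are \<open>-(2i + 1/2) (2i + 3/2)\<close>. This is where the
two residue classes of \<open>p\<close> modulo \<open>4\<close> are treated alike.\<close>

lemma half_binomial_cong_legendre:
  fixes p m i :: nat and h :: int
  assumes p: "prime p" and m: "p = 2 * m + 1" and h: "[4 * h = 1] (mod int p)" and "i < p"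
  shows "[int (m choose (2 * i)) * int ((2 * i) choose i) * (- h) ^ i
          = int ((p div 4) choose i) * int ((p div 4 + i) choose i)] (mod int p)"
  using \<open>i < p\<close>
proof (induction i)
  case 0
  then show ?case by simp
next
  case (Suc i)
  let ?P = "int p"
  define N where "N = p div 4"
  have IH: "[int (m choose (2 * i)) * int ((2 * i) choose i) * (- h) ^ i
          = int (N choose i) * int ((N + i) choose i)] (mod ?P)"
    using Suc unfolding N_def by simp
  have quad: "[(int m - 2 * int i) * (int m - 2 * int i - 1) = - 4 * ((int N - int i) * (int N + int i + 1))] (mod ?P)"
  proof -
    have "p = 4 * N + 1 \<or> p = 4 * N + 3" using m unfolding N_def by presburger
    then consider "int m = 2 * int N" "?P = 4 * int N + 1" | "int m = 2 * int N + 1" "?P = 4 * int N + 3"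
      using m by linarith
    then show ?thesis
    proof cases
      case 1
      then have "(int m - 2 * int i) * (int m - 2 * int i - 1) + 4 * ((int N - int i) * (int N + int i + 1))
          = ?P * (2 * (int N - int i))" by (simp add: algebra_simps)
      then show ?thesis by (simp add: cong_iff_dvd_diff)
    next
      case 2
      then have "(int m - 2 * int i) * (int m - 2 * int i - 1) + 4 * ((int N - int i) * (int N + int i + 1))
          = ?P * (2 * (int N - int i))" by (simp add: algebra_simps)
      then show ?thesis by (simp add: cong_iff_dvd_diff)
    qed
  qed
  have coef: "[(int m - 2 * int i) * (int m - 2 * int i - 1) * (- h) = (int N - int i) * (int N + int i + 1)] (mod ?P)"
  proof -
    have "[(int m - 2 * int i) * (int m - 2 * int i - 1) * (- h)
         = - 4 * ((int N - int i) * (int N + int i + 1)) * (- h)] (mod ?P)"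
      by (rule cong_scalar_right[OF quad])
    also have "- 4 * ((int N - int i) * (int N + int i + 1)) * (- h) = (int N - int i) * (int N + int i + 1) * (4 * h)"
      by (simp add: algebra_simps)
    also have "[\<dots> = (int N - int i) * (int N + int i + 1) * 1] (mod ?P)"
      by (rule cong_scalar_left[OF h])
    finally show ?thesis by simp
  qed
  have "int (Suc i) ^ 2 * (int (m choose (2 * Suc i)) * int ((2 * Suc i) choose Suc i) * (- h) ^ Suc i)
      = ((int m - 2 * int i) * (int m - 2 * int i - 1) * (- h))
         * (int (m choose (2 * i)) * int ((2 * i) choose i) * (- h) ^ i)"
    unfolding mult.assoc[symmetric] half_binomial_step[unfolded mult.assoc[symmetric]] power_Suc
    by (simp only: ac_simps)
  also have "[\<dots> = (int N - int i) * (int N + int i + 1) * (int (N choose i) * int ((N + i) choose i))] (mod ?P)"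
    by (rule cong_mult[OF coef IH])
  also have "(int N - int i) * (int N + int i + 1) * (int (N choose i) * int ((N + i) choose i))
      = int (Suc i) ^ 2 * (int (N choose Suc i) * int ((N + Suc i) choose Suc i))"
    by (rule legendre_binomial_step[symmetric])
  finally show ?case unfolding N_def[symmetric] using cong_cancel_Suc2 p Suc.prems by blast
qed

text \<open>Substitute \<open>j = m - i\<close> in the closed form of the alternating sum. The factor \<open>2j choose j\<close> becomes
\<open>(-4)^j (m choose j)\<close>, hence \<open>(-1)^m (m choose i) / (-4)^i\<close> by \<open>4^m = 2^(p - 1) \<equiv> 1\<close>, and
\<open>(m choose i) ((m - i) choose i) = (m choose 2i) (2i choose i)\<close> is treated by \<open>half_binomial_cong_legendre\<close>.\<close>

lemma reduced_sum_cong: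
  fixes p m :: nat and h :: int
  assumes p: "prime p" and m: "p = 2 * m + 1" and h: "[4 * h = 1] (mod int p)"
  shows "[(\<Sum>k\<le>m. (-1) ^ k * int (m choose k) * int (a_seq k))
    = (\<Sum>i\<le>p div 4. int ((p div 4) choose i) * int ((p div 4 + i) choose i)
                     * (int ((2 * i) choose i) * (- h) ^ i))] (mod int p)"
proof -
  let ?P = "int p"
  define N where "N = p div 4"
  have "N \<le> m" using m unfolding N_def by presburger
  have h4: "[(4 * h) ^ k = 1] (mod ?P)" for k
    using cong_pow[OF h, of k] by simp
  have four_m: "[4 ^ m = 1] (mod ?P)"
  proof -
    have "\<not> p dvd 2" using p m by (metis Suc_eq_plus1 dvd_triv_left even_Suc primes_dvd_imp_eq two_is_prime_nat)
    then have "[2 ^ (p - 1) = 1] (mod p)" using fermat_theorem[OF p, of 2] by simp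
    then have "[int (2 ^ (p - 1)) = int 1] (mod ?P)" by (simp only: cong_int_iff)
    moreover have "int (2 ^ (p - 1)) = 4 ^ m" using m by (simp add: power_mult)
    ultimately show ?thesis by simp
  qed
  have summand: "[(-1) ^ m * (int (m choose (m - i)) * int ((m - i) choose (m - (m - i))) * int ((2 * (m - i)) choose (m - i)))
      = int (N choose i) * int ((N + i) choose i) * (int ((2 * i) choose i) * (- h) ^ i)] (mod ?P)"
    if "i \<le> m" for i
  proof -
    have ip: "i < p" "m - i < p" using that m by linarith+
    have tri: "int (m choose (m - i)) * int ((m - i) choose (m - (m - i))) = int (m choose (2 * i)) * int ((2 * i) choose i)"
    proof (cases "2 * i \<le> m")
      case True
      then have "(m choose (2 * i)) * ((2 * i) choose i) = (m choose i) * ((m - i) choose i)"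
        using choose_mult[of i "2 * i" m] by simp
      moreover have "(m choose (m - i)) = (m choose i)"
        using that binomial_symmetric[of i m] by simp
      ultimately show ?thesis using that by (simp flip: of_nat_mult)
    next
      case False
      then show ?thesis using that by (simp add: binomial_eq_0)
    qed
    have "[(-1) ^ m * int ((2 * (m - i)) choose (m - i))
        = (-1) ^ m * int ((2 * (m - i)) choose (m - i)) * (4 * h) ^ (m - i)] (mod ?P)"
      using cong_scalar_left[OF cong_sym[OF h4[of "m - i"]]] by fastforce
    also have "(-1) ^ m * int ((2 * (m - i)) choose (m - i)) * (4 * h) ^ (m - i)
        = (-1) ^ m * 4 ^ (m - i) * (int ((2 * (m - i)) choose (m - i)) * h ^ (m - i))"
      by (simp add: power_mult_distrib)
    also have "[\<dots> = (-1) ^ m * 4 ^ (m - i) * ((-1) ^ (m - i) * int (m choose (m - i)))] (mod ?P)"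
      by (rule cong_scalar_left[OF central_binomial_cong_half[OF p m h ip(2)]])
    also have "(-1) ^ m * 4 ^ (m - i) * ((-1) ^ (m - i) * int (m choose (m - i)))
        = (4 ^ (m - i) * 1) * ((-1) ^ i * int (m choose i))"
    proof -
      have "(-1 :: int) ^ m * (-1) ^ (m - i) = (-1) ^ i"
      proof -
        have "(-1 :: int) ^ m = (-1) ^ i * (-1) ^ (m - i)" using that by (simp flip: power_add)
        moreover have "(-1 :: int) ^ (m - i) * (-1) ^ (m - i) = 1" by (simp flip: power_mult_distrib)
        ultimately show ?thesis by (metis mult.assoc mult.right_neutral)
      qed
      then show ?thesis using binomial_symmetric[OF that] by (metis mult.assoc mult.commute mult.right_neutral)
    qed
    also have "[\<dots> = (4 ^ (m - i) * (4 * h) ^ i) * ((-1) ^ i * int (m choose i))] (mod ?P)"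
      by (rule cong_scalar_right[OF cong_scalar_left[OF cong_sym[OF h4]]])
    also have "(4 ^ (m - i) * (4 * h) ^ i) * ((-1) ^ i * int (m choose i)) = 4 ^ m * ((- h) ^ i * int (m choose i))"
    proof -
      have "(4::int) ^ m = 4 ^ (m - i) * 4 ^ i" using that by (simp flip: power_add)
      moreover have "(- h) ^ i = (-1) ^ i * h ^ i" by (rule power_minus)
      ultimately show ?thesis by (simp add: power_mult_distrib)
    qed
    also have "[\<dots> = 1 * ((- h) ^ i * int (m choose i))] (mod ?P)"
      by (rule cong_scalar_right[OF four_m])
    finally have 1: "[(-1) ^ m * int ((2 * (m - i)) choose (m - i)) = (- h) ^ i * int (m choose i)] (mod ?P)"
      by simp
    have "int ((2 * i) choose i) * (- h) ^ i = (-1) ^ i * (int ((2 * i) choose i) * h ^ i)"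
      by (subst power_minus) simp
    also have "[\<dots> = (-1) ^ i * ((-1) ^ i * int (m choose i))] (mod ?P)"
      by (rule cong_scalar_left[OF central_binomial_cong_half[OF p m h ip(1)]])
    also have "(-1) ^ i * ((-1) ^ i * int (m choose i)) = int (m choose i)"
      by (simp add: mult.assoc[symmetric] flip: power_mult_distrib)
    finally have 2: "[int ((2 * i) choose i) * (- h) ^ i = int (m choose i)] (mod ?P)" .
    have "(-1) ^ m * (int (m choose (m - i)) * int ((m - i) choose (m - (m - i))) * int ((2 * (m - i)) choose (m - i)))
        = int (m choose (2 * i)) * int ((2 * i) choose i) * ((-1) ^ m * int ((2 * (m - i)) choose (m - i)))"
      unfolding tri by (simp only: ac_simps)
    also have "[\<dots> = int (m choose (2 * i)) * int ((2 * i) choose i) * ((- h) ^ i * int (m choose i))] (mod ?P)"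
      by (rule cong_scalar_left[OF 1])
    also have "int (m choose (2 * i)) * int ((2 * i) choose i) * ((- h) ^ i * int (m choose i))
        = (int (m choose (2 * i)) * int ((2 * i) choose i) * (- h) ^ i) * int (m choose i)"
      by (simp only: ac_simps)
    also have "[\<dots> = int (N choose i) * int ((N + i) choose i) * (int ((2 * i) choose i) * (- h) ^ i)] (mod ?P)"
      unfolding N_def by (rule cong_mult[OF half_binomial_cong_legendre[OF p m h ip(1)] cong_sym[OF 2]])
    finally show ?thesis .
  qed
  have "(\<Sum>k\<le>m. (-1) ^ k * int (m choose k) * int (a_seq k))
      = (\<Sum>j\<le>m. (-1) ^ m * (int (m choose j) * int (j choose (m - j)) * int ((2 * j) choose j)))"
    unfolding alternating_sum_a_seq sum_distrib_left ..
  also have "\<dots> = (\<Sum>i\<le>m. (-1) ^ m * (int (m choose (m - i)) * int ((m - i) choose (m - (m - i))) * int ((2 * (m - i)) choose (m - i))))"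
    by (rule sum.reindex_bij_witness[of _ "\<lambda>i. m - i" "\<lambda>j. m - j"]) auto
  finally have reindexed: "(\<Sum>k\<le>m. (-1) ^ k * int (m choose k) * int (a_seq k)) = \<dots>" .
  have truncated: "(\<Sum>i\<le>m. int (N choose i) * int ((N + i) choose i) * (int ((2 * i) choose i) * (- h) ^ i))
      = (\<Sum>i\<le>N. int (N choose i) * int ((N + i) choose i) * (int ((2 * i) choose i) * (- h) ^ i))"
    using \<open>N \<le> m\<close> by (intro sum.mono_neutral_right) (auto simp: binomial_eq_0)
  show ?thesis
    unfolding reindexed N_def[symmetric] truncated[symmetric] by (rule cong_sum) (use summand in auto)
qed

theorem sum_cong_binomial_square:
  fixes p m :: nat and h :: int
  assumes p: "prime p" and m: "p = 2 * m + 1" and h: "[4 * h = 1] (mod int p)"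
  shows "[(\<Sum>k = 0..p - 1. int ((2 * k) choose k) * int (a_seq k) * h ^ k)
    = (if even (p div 4) then int (m choose (p div 8)) ^ 2 else 0)] (mod int p)"
proof -
  let ?P = "int p"
  define N where "N = p div 4"
  have h4: "[(4 * h) ^ k = 1] (mod ?P)" for k
    using cong_pow[OF h, of k] by simp
  have "[(\<Sum>k = 0..p - 1. int ((2 * k) choose k) * int (a_seq k) * h ^ k)
      = (\<Sum>k = 0..p - 1. (-1) ^ k * int (m choose k) * int (a_seq k))] (mod ?P)"
  proof (rule cong_sum)
    fix k assume "k \<in> {0..p - 1}"
    then have "k < p" using m by auto
    from cong_scalar_right[OF central_binomial_cong_half[OF p m h this], of "int (a_seq k)"]
    show "[int ((2 * k) choose k) * int (a_seq k) * h ^ k = (-1) ^ k * int (m choose k) * int (a_seq k)] (mod ?P)"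
      by (simp add: ac_simps)
  qed
  also have "(\<Sum>k = 0..p - 1. (-1) ^ k * int (m choose k) * int (a_seq k))
      = (\<Sum>k\<le>m. (-1) ^ k * int (m choose k) * int (a_seq k))"
    using m by (intro sum.mono_neutral_right) (auto simp: binomial_eq_0)
  also note reduced_sum_cong[OF p m h, folded N_def]
  also have "[(\<Sum>i\<le>N. int (N choose i) * int ((N + i) choose i) * (int ((2 * i) choose i) * (- h) ^ i))
      = (\<Sum>i\<le>N. h ^ N * (int (N choose i) * int ((N + i) choose i) * (int ((2 * i) choose i) * ((-1) ^ i * 4 ^ (N - i)))))] (mod ?P)"
  proof (rule cong_sum)
    fix i assume "i \<in> {..N}"
    then have "h ^ N * ((-1) ^ i * 4 ^ (N - i)) = (- h) ^ i * (4 * h) ^ (N - i)"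
      by (subst power_minus) (simp add: power_mult_distrib flip: power_add)
    then have "[h ^ N * ((-1) ^ i * 4 ^ (N - i)) = (- h) ^ i * 1] (mod ?P)"
      using cong_scalar_left[OF h4] by metis
    from cong_scalar_left[OF cong_sym[OF this], of "int (N choose i) * int ((N + i) choose i) * int ((2 * i) choose i)"]
    show "[int (N choose i) * int ((N + i) choose i) * (int ((2 * i) choose i) * (- h) ^ i)
       = h ^ N * (int (N choose i) * int ((N + i) choose i) * (int ((2 * i) choose i) * ((-1) ^ i * 4 ^ (N - i))))] (mod ?P)"
      by (simp add: ac_simps)
  qed
  also have "(\<Sum>i\<le>N. h ^ N * (int (N choose i) * int ((N + i) choose i) * (int ((2 * i) choose i) * ((-1) ^ i * 4 ^ (N - i)))))
      = h ^ N * (if even N then int (N choose (N div 2)) ^ 2 else 0)"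
    unfolding sum_distrib_left[symmetric] legendre_moment_int ..
  also have "[\<dots> = (if even N then int (m choose (p div 8)) ^ 2 else 0)] (mod ?P)"
  proof (cases "even N")
    case True
    then obtain n where n: "N = 2 * n" by blast
    have "p div 8 = N div 2" unfolding N_def by (simp flip: div_mult2_eq)
    then have n8: "n = p div 8" using n by simp
    have n_less: "n < p" using p prime_gt_0_nat[of p] unfolding n8 by (intro div_less_dividend) auto
    have "h ^ N * int (N choose (N div 2)) ^ 2 = (int ((2 * n) choose n) * h ^ n) ^ 2"
      unfolding n by (simp add: power_mult_distrib power_mult[symmetric] mult.commute)
    also have "[\<dots> = ((-1) ^ n * int (m choose n)) ^ 2] (mod ?P)"
      by (rule cong_pow[OF central_binomial_cong_half[OF p m h n_less]])
    also have "((-1) ^ n * int (m choose n)) ^ 2 = int (m choose n) ^ 2"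
      by (simp add: power_mult_distrib flip: power_mult)
    finally show ?thesis using True n8 by simp
  next
    case False
    then show ?thesis by simp
  qed
  finally show ?thesis unfolding N_def .
qed

section \<open>Sums over residues modulo a prime\<close>

text \<open>Residues are represented by the integers in \<open>{0..<P}\<close> and functions on residues by periodic functions,
so a substitution need be invertible only modulo \<open>P\<close>.\<close>

lemma sum_reindex_mod:
  fixes f :: "int \<Rightarrow> 'b::comm_monoid_add" and g h :: "int \<Rightarrow> int"
  assumes per: "\<And>t. f (t mod P) = f t"
    and gB: "\<And>t. t \<in> A \<Longrightarrow> g t mod P \<in> B" and hA: "\<And>r. r \<in> B \<Longrightarrow> h r mod P \<in> A"
    and hg: "\<And>t. t \<in> A \<Longrightarrow> h (g t mod P) mod P = t" and gh: "\<And>r. r \<in> B \<Longrightarrow> g (h r mod P) mod P = r"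
  shows "(\<Sum>t\<in>A. f (g t)) = sum f B"
proof -
  have "(\<Sum>t\<in>A. f (g t)) = (\<Sum>t\<in>A. f (g t mod P))" by (simp add: per)
  also have "\<dots> = sum f B"
    by (rule sum.reindex_bij_witness[of _ "\<lambda>r. h r mod P" "\<lambda>t. g t mod P"]) (use assms in auto)
  finally show ?thesis .
qed

lemma cong_inverse_exists:
  fixes a P :: int
  assumes "prime P" "\<not> P dvd a"
  obtains b where "[a * b = 1] (mod P)" "\<not> P dvd b"
proof -
  have "coprime a P" using assms by (metis coprime_commute prime_imp_coprime)
  then obtain b where b: "[a * b = 1] (mod P)" using cong_solve_coprime_int by blast
  moreover have "\<not> P dvd b"
  proof
    assume "P dvd b"
    then have "P dvd a * b" by simp
    then have "P dvd 1" using b cong_dvd_iff by blast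
    then show False using assms(1) not_prime_unit by blast
  qed
  ultimately show ?thesis by (rule that)
qed

lemma sum_affine_mod:
  fixes f :: "int \<Rightarrow> 'b::comm_monoid_add"
  assumes P: "prime P" and per: "\<And>t. f (t mod P) = f t" and a: "\<not> P dvd a"
  shows "(\<Sum>t\<in>{0..<P}. f (a * t + b)) = (\<Sum>t\<in>{0..<P}. f t)"
proof -
  obtain c where c: "[a * c = 1] (mod P)" using cong_inverse_exists[OF P a] by blast
  have pos: "P > 0" using P prime_gt_0_int by blast
  have 1: "[c * ((a * t + b) - b) = t] (mod P)" for t
    using cong_scalar_right[OF c, of t] by (simp add: algebra_simps)
  have 2: "[a * (c * (r - b)) + b = r] (mod P)" for r
    using cong_add[OF cong_scalar_right[OF c, of "r - b"] cong_refl[of b]] by (simp add: algebra_simps)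
  show ?thesis
  proof (rule sum_reindex_mod[where h = "\<lambda>r. c * (r - b)" and P = P and f = f])
    show "c * ((a * t + b) mod P - b) mod P = t" if "t \<in> {0..<P}" for t
    proof -
      have "c * ((a * t + b) mod P - b) mod P = c * ((a * t + b) - b) mod P"
        by (metis mod_diff_left_eq mod_mult_right_eq)
      then show ?thesis using 1[of t] that by (simp add: cong_def)
    qed
    show "(a * (c * (r - b) mod P) + b) mod P = r" if "r \<in> {0..<P}" for r
    proof -
      have "(a * (c * (r - b) mod P) + b) mod P = (a * (c * (r - b)) + b) mod P"
        by (metis mod_add_left_eq mod_mult_right_eq)
      then show ?thesis using 2[of r] that by (simp add: cong_def)
    qed
  qed (use per pos in auto)
qed

lemma sum_character_eq_0:
  fixes \<psi> :: "int \<Rightarrow> complex"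
  assumes P: "prime P" and per: "\<And>t. \<psi> (t mod P) = \<psi> t" and mult: "\<And>s t. \<psi> (s * t) = \<psi> s * \<psi> t"
    and g: "\<not> P dvd g" "\<psi> g \<noteq> 1"
  shows "(\<Sum>t\<in>{0..<P}. \<psi> t) = 0"
proof -
  have "(\<Sum>t\<in>{0..<P}. \<psi> t) = (\<Sum>t\<in>{0..<P}. \<psi> (g * t + 0))"
    by (rule sum_affine_mod[where f = \<psi>, OF P per g(1), symmetric])
  also have "\<dots> = \<psi> g * (\<Sum>t\<in>{0..<P}. \<psi> t)" by (simp add: mult sum_distrib_left)
  finally show ?thesis using g(2) by simp
qed

lemma exists_power_not_cong_1:
  fixes p k :: nat
  assumes p: "prime p" and k: "\<not> (p - 1) dvd k"
  obtains g :: int where "\<not> int p dvd g" "\<not> [g ^ k = 1] (mod int p)"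
proof -
  have "p > 1" using p prime_gt_1_nat by blast
  obtain g where g: "residue_primroot p g" using p prime_primitive_root_exists[of p] \<open>p > 1\<close> by blast
  then have cop: "coprime p g" and o: "ord p g = totient p" by (auto simp: residue_primroot_def)
  have "\<not> [g ^ k = 1] (mod p)"
    using k o p ord_divides[of g k p] by (simp add: totient_prime)
  then have "\<not> [int g ^ k = 1] (mod int p)"
    by (metis cong_int_iff of_nat_1 of_nat_power)
  moreover have "\<not> int p dvd int g"
    using cop p by (metis coprime_absorb_left int_dvd_int_iff not_prime_unit)
  ultimately show ?thesis using that by blast
qed

text \<open>Fermat's theorem settles the exponents divisible by \<open>p - 1\<close>. For the others, substituting \<open>g * t\<close>
multiplies the sum by \<open>g^k\<close>, which is not congruent to \<open>1\<close> for a suitable \<open>g\<close>. With \<open>k = 0\<close> the term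
\<open>0^0 = 1\<close> makes the sum equal to \<open>p\<close>.\<close>

lemma sum_powers_mod_prime:
  fixes p k :: nat
  assumes p: "prime p"
  shows "[(\<Sum>t\<in>{0..<int p}. t ^ k) = (if k > 0 \<and> (p - 1) dvd k then - 1 else 0)] (mod int p)"
proof -
  let ?P = "int p"
  have p1: "p > 1" using p prime_gt_1_nat by blast
  have P: "prime ?P" using p by simp
  consider "k = 0" | "k > 0" "(p - 1) dvd k" | "k > 0" "\<not> (p - 1) dvd k" by blast
  then show ?thesis
  proof cases
    case 1
    then show ?thesis by (simp add: cong_def)
  next
    case 2
    then obtain l where l: "k = (p - 1) * l" by blast
    have "[(\<Sum>t\<in>{0..<?P}. t ^ k) = (\<Sum>t\<in>{0..<?P}. if t = 0 then 0 else 1)] (mod ?P)"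
    proof (rule cong_sum)
      fix t assume t: "t \<in> {0..<?P}"
      show "[t ^ k = (if t = 0 then 0 else 1)] (mod ?P)"
      proof (cases "t = 0")
        case False
        then have "\<not> p dvd nat t" using t by (auto dest: dvd_imp_le)
        then have "[nat t ^ (p - 1) = 1] (mod p)" by (rule fermat_theorem[OF p])
        then have "[int (nat t) ^ (p - 1) = 1] (mod ?P)"
          by (metis cong_int_iff of_nat_1 of_nat_power)
        then have "[t ^ (p - 1) = 1] (mod ?P)" using t by simp
        from cong_pow[OF this, of l] show ?thesis using False by (simp add: l power_mult)
      qed (use 2 in \<open>simp add: zero_power\<close>)
    qed
    also have "(\<Sum>t\<in>{0..<?P}. if t = 0 then 0 else (1::int)) = (\<Sum>t\<in>{0..<?P} - {0}. 1)"
      using p1 by (intro sum.mono_neutral_cong_right) auto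
    also have "\<dots> = ?P - 1" using p1 by (simp add: of_nat_diff)
    also have "[?P - 1 = - 1] (mod ?P)" by (simp add: cong_def)
    finally show ?thesis using 2 by simp
  next
    case 3
    obtain g where g: "\<not> ?P dvd g" "\<not> [g ^ k = 1] (mod ?P)" using exists_power_not_cong_1[OF p 3(2)] by blast
    define S where "S = (\<Sum>t\<in>{0..<?P}. t ^ k)"
    have red: "[(\<Sum>t\<in>{0..<?P}. f t mod ?P) = (\<Sum>t\<in>{0..<?P}. f t)] (mod ?P)" for f :: "int \<Rightarrow> int"
      by (rule cong_sum) (simp add: cong_def)
    have "[S = (\<Sum>t\<in>{0..<?P}. t ^ k mod ?P)] (mod ?P)"
      unfolding S_def by (rule cong_sym[OF red])
    also have "(\<Sum>t\<in>{0..<?P}. t ^ k mod ?P) = (\<Sum>t\<in>{0..<?P}. (g * t + 0) ^ k mod ?P)"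
      by (rule sum_affine_mod[OF P _ g(1), symmetric, where f = "\<lambda>t. t ^ k mod ?P"]) (simp add: power_mod)
    also have "[\<dots> = (\<Sum>t\<in>{0..<?P}. (g * t + 0) ^ k)] (mod ?P)" by (rule red)
    also have "(\<Sum>t\<in>{0..<?P}. (g * t + 0) ^ k) = g ^ k * S"
      unfolding S_def by (simp add: power_mult_distrib sum_distrib_left)
    finally have "?P dvd (g ^ k - 1) * S"
      by (metis cong_iff_dvd_diff cong_sym left_diff_distrib mult_1)
    then have "?P dvd S" using g(2) P prime_dvd_mult_iff unfolding cong_iff_dvd_diff by blast
    then show ?thesis using 3 unfolding S_def by (simp add: cong_0_iff)
  qed
qed

lemma fermat_int:
  fixes p :: nat and t :: int
  assumes p: "prime p" and t: "\<not> int p dvd t"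
  shows "[t ^ (p - 1) = 1] (mod int p)"
proof -
  have pos: "int p > 0" using p prime_gt_0_nat by simp
  have "\<not> int p dvd t mod int p" using t by (simp add: dvd_mod_iff)
  then have "\<not> p dvd nat (t mod int p)" using pos by (simp add: int_dvd_int_iff[symmetric])
  then have "[nat (t mod int p) ^ (p - 1) = 1] (mod p)" by (rule fermat_theorem[OF p])
  then have "[int (nat (t mod int p)) ^ (p - 1) = 1] (mod int p)"
    by (metis cong_int_iff of_nat_1 of_nat_power)
  then show ?thesis using pos by (simp add: cong_def power_mod)
qed

lemma sum_inverse_mod:
  fixes f :: "int \<Rightarrow> 'b::comm_monoid_add" and iv :: "int \<Rightarrow> int"
  assumes P: "prime P" and per: "\<And>t. f (t mod P) = f t"
    and iv: "\<And>t. \<not> P dvd t \<Longrightarrow> [t * iv t = 1] (mod P)"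
  shows "(\<Sum>t\<in>{1..<P}. f (iv t)) = (\<Sum>t\<in>{1..<P}. f t)"
proof -
  have pos: "P > 1" using P prime_gt_1_int by blast
  have units: "\<not> P dvd t" if "t \<in> {1..<P}" for t
    using that by (auto dest: zdvd_imp_le)
  have inv_unit: "\<not> P dvd iv t" if "\<not> P dvd t" for t
  proof
    assume "P dvd iv t"
    then have "P dvd t * iv t" by simp
    then have "P dvd 1" using iv[OF that] cong_dvd_iff by blast
    then show False using P not_prime_unit by blast
  qed
  have mem: "iv t mod P \<in> {1..<P}" if "t \<in> {1..<P}" for t
  proof -
    have "iv t mod P \<noteq> 0" using inv_unit[OF units[OF that]] by (simp add: dvd_eq_mod_eq_0)
    moreover have "0 \<le> iv t mod P" "iv t mod P < P" using pos by simp_all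
    ultimately show ?thesis unfolding atLeastLessThan_iff by linarith
  qed
  have involutive: "iv (iv t mod P) mod P = t" if t: "t \<in> {1..<P}" for t
  proof -
    define u where "u = iv t mod P"
    have u: "[u = iv t] (mod P)" by (simp add: u_def cong_def)
    have "\<not> P dvd u" using units[OF mem[OF t]] by (simp add: u_def)
    then have "[u * iv u = 1] (mod P)" by (rule iv)
    then have "[t * (u * iv u) = t * 1] (mod P)" by (rule cong_scalar_left)
    moreover have "[(t * u) * iv u = 1 * iv u] (mod P)"
      by (intro cong_scalar_right cong_trans[OF cong_scalar_left[OF u] iv[OF units[OF t]]])
    ultimately have "[iv u = t] (mod P)"
      by (metis cong_sym cong_trans mult.assoc mult_1 mult.right_neutral)
    then show ?thesis using t by (simp add: cong_def u_def)
  qed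
  show ?thesis
    by (rule sum_reindex_mod[where h = iv and P = P and f = f]) (use per mem involutive in auto)
qed

lemma dvd_below_double:
  fixes i d :: nat
  assumes "0 < i" "i < 2 * d"
  shows "d dvd i \<longleftrightarrow> i = d"
proof
  assume "d dvd i"
  then obtain c where c: "i = d * c" by blast
  then have "c < 2" using assms(2) by (metis mult.commute mult_less_cancel1)
  moreover have "c \<noteq> 0" using c assms(1) by (intro notI) simp
  ultimately have "c = 1" by linarith
  then show "i = d" using c by simp
qed simp

text \<open>Only the exponent \<open>p - 1\<close> contributes, as the degree stays below \<open>2 * (p - 1)\<close>.\<close>

lemma sum_power_times_shifted_power:
  fixes p k m :: nat
  assumes p: "prime p" and k: "0 < k" "k \<le> p - 1" "k + m < 2 * (p - 1)"
  shows "[(\<Sum>t\<in>{0..<int p}. t ^ k * (1 + t) ^ m) = - int (m choose (p - 1 - k))] (mod int p)"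
proof -
  let ?P = "int p"
  have "(\<Sum>t\<in>{0..<?P}. t ^ k * (1 + t) ^ m)
      = (\<Sum>t\<in>{0..<?P}. \<Sum>j\<le>m. int (m choose j) * t ^ (k + j))"
    by (rule sum.cong[OF refl])
       (simp add: add.commute[of 1] binomial_ring sum_distrib_left power_add mult_ac)
  also have "\<dots> = (\<Sum>j\<le>m. int (m choose j) * (\<Sum>t\<in>{0..<?P}. t ^ (k + j)))"
    by (subst sum.swap) (simp add: sum_distrib_left)
  finally have eq: "(\<Sum>t\<in>{0..<?P}. t ^ k * (1 + t) ^ m) = \<dots>" .
  have dvd: "(p - 1) dvd (k + j) \<longleftrightarrow> j = p - 1 - k" if "j \<le> m" for j
    using dvd_below_double[of "k + j" "p - 1"] k that by auto
  have "[(\<Sum>j\<le>m. int (m choose j) * (\<Sum>t\<in>{0..<?P}. t ^ (k + j)))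
      = (\<Sum>j\<le>m. int (m choose j) * (if j = p - 1 - k then - 1 else 0))] (mod ?P)"
  proof (rule cong_sum)
    fix j assume "j \<in> {..m}"
    then show "[int (m choose j) * (\<Sum>t\<in>{0..<?P}. t ^ (k + j))
        = int (m choose j) * (if j = p - 1 - k then - 1 else 0)] (mod ?P)"
      using cong_scalar_left[OF sum_powers_mod_prime[OF p, of "k + j"]] dvd k by simp
  qed
  also have "(\<Sum>j\<le>m. int (m choose j) * (if j = p - 1 - k then - 1 else 0))
      = (\<Sum>j\<le>m. if j = p - 1 - k then - int (m choose j) else 0)"
    by (rule sum.cong) auto
  also have "\<dots> = - int (m choose (p - 1 - k))" by (simp add: sum.delta binomial_eq_0)
  finally show ?thesis unfolding eq .
qed

section \<open>Eighth roots of unity modulo a prime element\<close>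

definition zeta8 :: complex where
  "zeta8 = Complex (sqrt 2 / 2) (sqrt 2 / 2)"

lemma zeta8_sq: "zeta8 ^ 2 = \<i>"
  by (simp add: zeta8_def power2_eq_square complex_eq_iff)

lemma zeta8_pow4: "zeta8 ^ 4 = -1"
proof -
  have "zeta8 ^ 4 = (zeta8 ^ 2) ^ 2" by (simp flip: power_mult)
  then show ?thesis by (simp add: zeta8_sq)
qed

lemma zeta8_pow8: "zeta8 ^ 8 = 1"
proof -
  have "zeta8 ^ 8 = (zeta8 ^ 4) ^ 2" by (simp flip: power_mult)
  then show ?thesis by (simp add: zeta8_pow4)
qed

lemma zeta8_cnj: "zeta8 * cnj zeta8 = 1"
  by (simp add: zeta8_def complex_eq_iff)

text \<open>A prime element \<open>q\<close> of a commutative ring and an element \<open>\<omega>\<close> that is a primitive eighth root of unity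
modulo \<open>q\<close>. The rings in question are the integers, with \<open>q = p \<equiv> 1 (mod 8)\<close>, and the Gaussian
integers, with the inert prime \<open>q = p \<equiv> 3 (mod 8)\<close>.\<close>

locale octic_root =
  fixes q \<omega> :: "'a::comm_ring_1"
  assumes prime: "prime_elem q" and not_dvd_2: "\<not> q dvd 2" and root: "q dvd \<omega> ^ 4 + 1"
begin

definition eqv :: "'a \<Rightarrow> 'a \<Rightarrow> bool" (infix "\<approx>" 50) where
  "x \<approx> y \<longleftrightarrow> q dvd x - y"

lemma eqv_refl [simp]: "x \<approx> x"
  by (simp add: eqv_def)

lemma eqv_sym: "x \<approx> y \<Longrightarrow> y \<approx> x"
  by (metis eqv_def dvd_minus_iff minus_diff_eq)

lemma eqv_trans [trans]: "x \<approx> y \<Longrightarrow> y \<approx> z \<Longrightarrow> x \<approx> z"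
  unfolding eqv_def using dvd_add[of q "x - y" "y - z"] by simp

lemma eqv_add: "x \<approx> y \<Longrightarrow> x' \<approx> y' \<Longrightarrow> x + x' \<approx> y + y'"
  unfolding eqv_def using dvd_add[of q "x - y" "x' - y'"] by (simp add: algebra_simps)

lemma eqv_diff: "x \<approx> y \<Longrightarrow> x' \<approx> y' \<Longrightarrow> x - x' \<approx> y - y'"
  unfolding eqv_def using dvd_diff[of q "x - y" "x' - y'"] by (simp add: algebra_simps)

lemma eqv_mult: "x \<approx> y \<Longrightarrow> x' \<approx> y' \<Longrightarrow> x * x' \<approx> y * y'"
proof -
  assume "x \<approx> y" "x' \<approx> y'"
  then have "q dvd (x - y) * x' + y * (x' - y')"
    unfolding eqv_def by (simp add: dvd_mult dvd_mult2)
  then show ?thesis unfolding eqv_def by (simp add: algebra_simps)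
qed

lemma eqv_power: "x \<approx> y \<Longrightarrow> x ^ k \<approx> y ^ k"
  by (induction k) (auto intro: eqv_mult)

lemma eqv_sum: "(\<And>i. i \<in> A \<Longrightarrow> f i \<approx> g i) \<Longrightarrow> sum f A \<approx> sum g A"
  by (induction A rule: infinite_finite_induct) (auto intro: eqv_add)

lemma eqv_dvd: "x \<approx> y \<Longrightarrow> q dvd x \<longleftrightarrow> q dvd y"
  unfolding eqv_def by (metis diff_add_cancel dvd_add_right_iff dvd_add_left_iff)

lemma not_dvd_1: "\<not> q dvd 1"
  using prime by (auto simp: prime_elem_def)

lemma not_eqv_neg: "\<not> 1 \<approx> - 1"
  using not_dvd_2 by (simp add: eqv_def)

lemma omega_pow4: "\<omega> ^ 4 \<approx> - 1"
  using root by (simp add: eqv_def)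

lemma omega_pow8: "\<omega> ^ 8 \<approx> 1"
proof -
  have "\<omega> ^ 8 = (\<omega> ^ 4) ^ 2" by (simp flip: power_mult)
  then show ?thesis using eqv_power[OF omega_pow4, of 2] by simp
qed

lemma omega_pow_not_dvd: "\<not> q dvd \<omega> ^ k"
proof
  assume "q dvd \<omega> ^ k"
  then have "q dvd \<omega>" using prime prime_elem_dvd_power by blast
  then have "q dvd \<omega> ^ 4" by (simp add: dvd_power_same dvd_trans[OF _ dvd_power])
  then show False using root not_dvd_1 by (metis dvd_add_right_iff)
qed

lemma omega_pow_mod: "\<omega> ^ k \<approx> \<omega> ^ (k mod 8)"
proof -
  have "\<omega> ^ k = (\<omega> ^ 8) ^ (k div 8) * \<omega> ^ (k mod 8)"
    by (metis mult_div_mod_eq power_add power_mult)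
  also have "\<dots> \<approx> 1 ^ (k div 8) * \<omega> ^ (k mod 8)"
    by (intro eqv_mult eqv_power omega_pow8 eqv_refl)
  finally show ?thesis by simp
qed

lemma zeta8_pow_mod: "zeta8 ^ k = zeta8 ^ (k mod 8)"
proof -
  have "zeta8 ^ k = (zeta8 ^ 8) ^ (k div 8) * zeta8 ^ (k mod 8)"
    by (metis mult_div_mod_eq power_add power_mult)
  then show ?thesis by (simp add: zeta8_pow8)
qed

lemma omega_pow_eq_1:
  assumes "\<omega> ^ d \<approx> 1"
  shows "d mod 8 = 0"
proof (rule ccontr)
  define r where "r = d mod 8"
  assume "d mod 8 \<noteq> 0"
  then have r: "r \<in> {1, 3, 5, 7} \<or> r \<in> {2, 6} \<or> r = 4"
    unfolding r_def by (simp, presburger)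
  have one: "\<omega> ^ r \<approx> 1"
    using eqv_trans[OF eqv_sym[OF omega_pow_mod] assms] unfolding r_def .
  have pow: "(\<omega> ^ r) ^ j \<approx> 1" for j using eqv_power[OF one, of j] by simp
  have neg: "\<exists>j. (\<omega> ^ r) ^ j \<approx> - 1"
  proof -
    consider "odd r" | "r \<in> {2, 6}" | "r = 4" using r by auto
    then show ?thesis
    proof cases
      case 1
      have "(\<omega> ^ r) ^ 4 = (\<omega> ^ 4) ^ r" by (simp flip: power_mult add: mult.commute)
      then show ?thesis using eqv_power[OF omega_pow4, of r] 1 by (metis power_minus_odd power_one)
    next
      case 2
      then have "(\<omega> ^ r) ^ 2 = (\<omega> ^ 4) ^ (r div 2)" by (auto simp flip: power_mult)
      moreover have "odd (r div 2)" using 2 by auto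
      ultimately show ?thesis using eqv_power[OF omega_pow4, of "r div 2"] by (metis power_minus_odd power_one)
    next
      case 3
      then show ?thesis using omega_pow4 by (metis power_one_right)
    qed
  qed
  then show False using pow not_eqv_neg eqv_sym eqv_trans by blast
qed

lemma zeta8_pow_cong:
  assumes "\<omega> ^ j \<approx> \<omega> ^ k"
  shows "zeta8 ^ j = zeta8 ^ k"
proof -
  have *: "zeta8 ^ j = zeta8 ^ (j + d)" if "\<omega> ^ j \<approx> \<omega> ^ (j + d)" for j d
  proof -
    have "q dvd \<omega> ^ j * (1 - \<omega> ^ d)" using that by (simp add: eqv_def power_add algebra_simps)
    then have "1 \<approx> \<omega> ^ d"
      using prime_elem_dvd_mult_iff[OF prime] omega_pow_not_dvd unfolding eqv_def by blast
    then have "d mod 8 = 0" by (rule omega_pow_eq_1[OF eqv_sym])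
    then have "zeta8 ^ d = 1" using zeta8_pow_mod[of d] by simp
    then show ?thesis by (simp add: power_add)
  qed
  show ?thesis
  proof (cases "j \<le> k")
    case True then show ?thesis using *[of j "k - j"] assms by simp
  next
    case False then show ?thesis using *[of k "j - k"] eqv_sym[OF assms] by simp
  qed
qed

text \<open>The Teichmueller lift \<open>\<omega>^k \<mapsto> \<zeta>^k\<close> to complex numbers, extended by zero. It is used only at elements
that are zero or an eighth root of unity modulo \<open>q\<close>; these are the elements called \<open>octic\<close>.\<close>

definition oct :: "'a \<Rightarrow> complex" where
  "oct y = (if q dvd y then 0 else zeta8 ^ (SOME k. y \<approx> \<omega> ^ k))"

definition octic :: "'a \<Rightarrow> bool" where
  "octic y \<longleftrightarrow> q dvd y \<or> y ^ 8 \<approx> 1"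

lemma oct_omega_pow:
  assumes "y \<approx> \<omega> ^ k"
  shows "oct y = zeta8 ^ k"
proof -
  have "y \<approx> \<omega> ^ (SOME k. y \<approx> \<omega> ^ k)" using assms by (rule someI)
  then have "zeta8 ^ (SOME k. y \<approx> \<omega> ^ k) = zeta8 ^ k"
    using zeta8_pow_cong assms eqv_sym eqv_trans by blast
  then show ?thesis using assms eqv_dvd omega_pow_not_dvd by (simp add: oct_def)
qed

lemma oct_zero: "q dvd y \<Longrightarrow> oct y = 0"
  by (simp add: oct_def)

lemma oct_one [simp]: "oct 1 = 1"
  using oct_omega_pow[of 1 0] by simp

lemma oct_neg_one [simp]: "oct (- 1) = - 1"
  using oct_omega_pow[OF eqv_sym[OF omega_pow4]] by (simp add: zeta8_pow4)

lemma eqv_square_cases: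
  assumes "x ^ 2 \<approx> (\<omega> ^ j) ^ 2"
  shows "x \<approx> \<omega> ^ j \<or> x \<approx> \<omega> ^ (j + 4)"
proof -
  have "q dvd (x - \<omega> ^ j) * (x + \<omega> ^ j)"
    using assms by (simp add: eqv_def power2_eq_square algebra_simps)
  then consider "x \<approx> \<omega> ^ j" | "x \<approx> - (\<omega> ^ j)"
    using prime_elem_dvd_mult_iff[OF prime] by (auto simp: eqv_def)
  then show ?thesis
  proof cases
    case 2
    have "\<omega> ^ j * \<omega> ^ 4 \<approx> \<omega> ^ j * - 1" by (intro eqv_mult eqv_refl omega_pow4)
    then show ?thesis using 2 eqv_sym eqv_trans by (metis mult_minus1_right power_add)
  qed simp
qed

lemma octic_cases:
  assumes "octic y"
  obtains "q dvd y" | k where "k < 8" "y \<approx> \<omega> ^ k"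
proof (cases "q dvd y")
  case False
  then have "(y ^ 4) ^ 2 \<approx> (\<omega> ^ 0) ^ 2" using assms by (simp add: octic_def flip: power_mult)
  then have "y ^ 4 \<approx> \<omega> ^ 0 \<or> y ^ 4 \<approx> \<omega> ^ 4" using eqv_square_cases by fastforce
  then have "(y ^ 2) ^ 2 \<approx> (\<omega> ^ 0) ^ 2 \<or> (y ^ 2) ^ 2 \<approx> (\<omega> ^ 2) ^ 2" by (simp flip: power_mult)
  then have "y ^ 2 \<approx> \<omega> ^ 0 \<or> y ^ 2 \<approx> \<omega> ^ 4 \<or> y ^ 2 \<approx> \<omega> ^ 2 \<or> y ^ 2 \<approx> \<omega> ^ 6"
    using eqv_square_cases[of "y ^ 2" 0] eqv_square_cases[of "y ^ 2" 2] by auto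
  then have "\<exists>j\<in>{0, 2, 1, 3}. y ^ 2 \<approx> (\<omega> ^ j) ^ 2" by (simp flip: power_mult)
  then obtain k where "y \<approx> \<omega> ^ k" using eqv_square_cases by blast
  then have "y \<approx> \<omega> ^ (k mod 8)" using eqv_trans omega_pow_mod by blast
  then show ?thesis using that(2)[of "k mod 8"] by simp
qed (use that in blast)

lemma oct_cong:
  assumes "octic x" "x \<approx> y"
  shows "oct x = oct y"
  using assms(1)
proof (cases rule: octic_cases)
  case 1 then show ?thesis using eqv_dvd[OF assms(2)] by (simp add: oct_zero)
next
  case (2 k) then show ?thesis using assms(2) eqv_sym eqv_trans oct_omega_pow by metis
qed

lemma octic_mult: "octic x \<Longrightarrow> octic y \<Longrightarrow> octic (x * y)"
  unfolding octic_def power_mult_distrib using eqv_mult[of "x ^ 8" 1 "y ^ 8" 1] by auto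

lemma octic_one [simp]: "octic 1"
  by (simp add: octic_def)

lemma octic_power: "octic x \<Longrightarrow> octic (x ^ k)"
  by (induction k) (auto intro: octic_mult)

lemma oct_mult:
  assumes "octic x" "octic y"
  shows "oct (x * y) = oct x * oct y"
  using assms(1)
proof (cases rule: octic_cases)
  case 1 then show ?thesis by (simp add: oct_zero)
next
  case x: (2 j)
  show ?thesis using assms(2)
  proof (cases rule: octic_cases)
    case 1 then show ?thesis by (simp add: oct_zero)
  next
    case (2 k)
    have "x * y \<approx> \<omega> ^ (j + k)" unfolding power_add using x 2 by (intro eqv_mult)
    then have "oct (x * y) = zeta8 ^ (j + k)" by (rule oct_omega_pow)
    then show ?thesis using x 2 by (simp add: oct_omega_pow power_add)
  qed
qed

lemma oct_power: "octic x \<Longrightarrow> oct (x ^ k) = oct x ^ k"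
  by (induction k) (auto simp: oct_mult octic_power)

lemma oct_norm:
  assumes "octic x" "\<not> q dvd x"
  shows "oct x * cnj (oct x) = 1"
  using assms(1)
proof (cases rule: octic_cases)
  case (2 k)
  have "zeta8 ^ k * cnj (zeta8 ^ k) = (zeta8 * cnj zeta8) ^ k"
    by (simp only: complex_cnj_power power_mult_distrib)
  then show ?thesis using 2 by (simp add: oct_omega_pow zeta8_cnj)
qed (use assms in blast)

lemma oct_pow8: "octic x \<Longrightarrow> \<not> q dvd x \<Longrightarrow> oct x ^ 8 = 1"
  by (metis octic_def oct_power oct_cong octic_power oct_one)

lemma octic_sign:
  assumes "x ^ 2 \<approx> 1"
  shows "octic x" "oct x = 1 \<or> oct x = - 1"
proof -
  from eqv_square_cases[of x 0] assms have "x \<approx> \<omega> ^ 0 \<or> x \<approx> \<omega> ^ 4" by simp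
  then show "oct x = 1 \<or> oct x = - 1" using oct_omega_pow zeta8_pow4 by fastforce
  have "x ^ 8 = (x ^ 2) ^ 4" by (simp flip: power_mult)
  then show "octic x" using eqv_power[OF assms, of 4] by (simp add: octic_def)
qed

text \<open>For \<open>z = \<zeta>^k\<close> the number \<open>z + z^3\<close> lies in \<open>\<int>[\<surd>-2]\<close>. The trace \<open>z + z^{-1}\<close>, read modulo \<open>q\<close>,
is an integer plus a multiple \<open>d\<close> of \<open>\<omega> - \<omega>^3\<close>, and \<open>d * \<surd>2\<close> is the real part of
\<open>z - z^3\<close>. Hence this multiple disappears in any sum over which \<open>z\<close> and \<open>z^3\<close> have equal
totals.\<close>

lemma oct_decompose:
  assumes "octic y"
  shows "\<exists>a b d. oct y + oct y ^ 3 = of_int (2 * a) + of_int b * (\<i> * sqrt 2)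
     \<and> Re (oct y - oct y ^ 3) = of_int d * sqrt 2
     \<and> y + y ^ 7 \<approx> of_int (2 * a) + of_int d * (\<omega> - \<omega> ^ 3)"
  using assms
proof (cases rule: octic_cases)
  case 1
  then have "y + y ^ 7 \<approx> 0" by (simp add: eqv_def dvd_add dvd_power_le[of q y 1, simplified])
  then show ?thesis using 1 by (intro exI[of _ 0]) (simp add: oct_zero)
next
  case (2 k)
  define w where "w = zeta8"
  have w: "w ^ 4 = - 1" "w + w ^ 3 = \<i> * sqrt 2" "Re (w - w ^ 3) = sqrt 2" "Re (w ^ 2) = 0"
    by (simp_all add: w_def zeta8_def power2_eq_square power3_eq_cube zeta8_pow4[unfolded zeta8_def] complex_eq_iff algebra_simps)
  have "w ^ 5 = w ^ 4 * w" "w ^ 6 = w ^ 4 * w ^ 2" "w ^ 7 = w ^ 4 * w ^ 3"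
    by (simp_all flip: power_Suc2 power_add)
  then have low: "w ^ 5 = - w" "w ^ 6 = - (w ^ 2)" "w ^ 7 = - (w ^ 3)"
    by (simp_all add: w(1))
  have "w ^ 9 = w ^ 1" "w ^ 12 = w ^ 4" "w ^ 15 = w ^ 7" "w ^ 18 = w ^ 2" "w ^ 21 = w ^ 5"
    using zeta8_pow_mod[of 9] zeta8_pow_mod[of 12] zeta8_pow_mod[of 15] zeta8_pow_mod[of 18] zeta8_pow_mod[of 21]
    by (simp_all add: w_def)
  then have pw: "w ^ 5 = - w" "w ^ 6 = - (w ^ 2)" "w ^ 7 = - (w ^ 3)" "w ^ 9 = w" "w ^ 12 = - 1"
      "w ^ 15 = - (w ^ 3)" "w ^ 18 = w ^ 2" "w ^ 21 = - w"
    using low w(1) by simp_all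
  have o: "oct y = w ^ k" "oct y ^ 3 = w ^ (3 * k)"
    using 2 by (simp_all add: oct_omega_pow w_def mult.commute power_mult)
  have yk: "y + y ^ 7 \<approx> \<omega> ^ k + \<omega> ^ (7 * k mod 8)"
  proof -
    have "y ^ 7 \<approx> \<omega> ^ (7 * k)" using eqv_power[OF 2(2), of 7] by (simp add: mult.commute flip: power_mult)
    then show ?thesis using 2(2) omega_pow_mod eqv_trans eqv_add by blast
  qed
  have om: "\<omega> ^ 4 \<approx> - 1" "\<omega> ^ 5 \<approx> - \<omega>" "\<omega> ^ 6 \<approx> - (\<omega> ^ 2)" "\<omega> ^ 7 \<approx> - (\<omega> ^ 3)"
    using omega_pow4 eqv_mult[OF omega_pow4 eqv_refl[of \<omega>]] eqv_mult[OF omega_pow4 eqv_refl[of "\<omega> ^ 2"]]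
      eqv_mult[OF omega_pow4 eqv_refl[of "\<omega> ^ 3"]] by (simp_all flip: power_Suc2 power_add)
  from 2(1) consider "k = 0" | "k = 1" | "k = 2" | "k = 3" | "k = 4" | "k = 5" | "k = 6" | "k = 7" by linarith
  then show ?thesis
  proof cases
    case 1
    then show ?thesis using yk by (intro exI[of _ 1] exI[of _ 0]) (simp add: o)
  next
    case k: 2
    have "\<omega> + \<omega> ^ 7 \<approx> \<omega> + - (\<omega> ^ 3)" by (intro eqv_add om eqv_refl)
    then show ?thesis using yk k w by (intro exI[of _ 0] exI[of _ 1]) (auto simp: o intro: eqv_trans)
  next
    case k: 3
    have "\<omega> ^ 2 + \<omega> ^ 6 \<approx> \<omega> ^ 2 + - (\<omega> ^ 2)" by (intro eqv_add om eqv_refl)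
    then show ?thesis using yk k w by (intro exI[of _ 0]) (auto simp: o pw intro: eqv_trans)
  next
    case k: 4
    have "\<omega> ^ 3 + \<omega> ^ 5 \<approx> \<omega> ^ 3 + - \<omega>" by (intro eqv_add om eqv_refl)
    then show ?thesis using yk k w
      by (intro exI[of _ 0] exI[of _ 1] exI[of _ "-1"]) (auto simp: o pw add.commute[of "w ^ 3"] intro: eqv_trans)
  next
    case k: 5
    have "\<omega> ^ 4 + \<omega> ^ 4 \<approx> - 1 + - 1" by (intro eqv_add om eqv_refl)
    then show ?thesis using yk k w
      by (intro exI[of _ "-1"] exI[of _ 0]) (auto simp: o pw intro: eqv_trans)
  next
    case k: 6
    have "\<omega> ^ 5 + \<omega> ^ 3 \<approx> - \<omega> + \<omega> ^ 3" by (intro eqv_add om eqv_refl)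
    moreover have "- w + - (w ^ 3) = - (\<i> * sqrt 2)" using w(2) by (simp flip: w(2))
    ultimately show ?thesis using yk k w(3)
      by (intro exI[of _ 0] exI[of _ "-1"]) (auto simp: o pw intro: eqv_trans)
  next
    case k: 7
    have "\<omega> ^ 6 + \<omega> ^ 2 \<approx> - (\<omega> ^ 2) + \<omega> ^ 2" by (intro eqv_add om eqv_refl)
    then show ?thesis using yk k w by (intro exI[of _ 0]) (auto simp: o pw intro: eqv_trans)
  next
    case k: 8
    have "\<omega> ^ 7 + \<omega> \<approx> - (\<omega> ^ 3) + \<omega>" by (intro eqv_add om eqv_refl)
    then show ?thesis using yk k w
      by (intro exI[of _ 0] exI[of _ "-1"] exI[of _ 1]) (auto simp: o pw algebra_simps intro: eqv_trans)
  qed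
qed

text \<open>The common last step for both kinds of primes: \<open>E\<close> is fixed by \<open>\<zeta> \<mapsto> \<zeta>^3\<close>, hence equals
\<open>A + (B / 2) * \<surd>-2\<close> with integers \<open>A\<close> and \<open>B\<close>, and its trace modulo \<open>q\<close> is \<open>2 * A\<close>.
The norm \<open>A^2 + B^2 / 2\<close> being an integer, \<open>B\<close> is even.\<close>

lemma octic_sum_norm_form:
  fixes y :: "'i \<Rightarrow> 'a" and P :: int
  assumes fin: "finite I" and oc: "\<And>t. t \<in> I \<Longrightarrow> octic (y t)"
    and cube: "(\<Sum>t\<in>I. oct (y t) ^ 3) = (\<Sum>t\<in>I. oct (y t))"
    and norm: "(\<Sum>t\<in>I. oct (y t)) * cnj (\<Sum>t\<in>I. oct (y t)) = of_int P"
  shows "\<exists>a b. P = a ^ 2 + 2 * b ^ 2 \<and> (\<Sum>t\<in>I. y t + y t ^ 7) \<approx> of_int (2 * a)"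
proof -
  define E where "E = (\<Sum>t\<in>I. oct (y t))"
  obtain a b d where abd: "\<And>t. t \<in> I \<Longrightarrow> oct (y t) + oct (y t) ^ 3 = of_int (2 * a t) + of_int (b t) * (\<i> * sqrt 2)"
    "\<And>t. t \<in> I \<Longrightarrow> Re (oct (y t) - oct (y t) ^ 3) = of_int (d t) * sqrt 2"
    "\<And>t. t \<in> I \<Longrightarrow> y t + y t ^ 7 \<approx> of_int (2 * a t) + of_int (d t) * (\<omega> - \<omega> ^ 3)"
    using oct_decompose[OF oc] by metis
  define A B D where "A = sum a I" and "B = sum b I" and "D = sum d I"
  have "of_int D * sqrt 2 = (\<Sum>t\<in>I. Re (oct (y t) - oct (y t) ^ 3))"
    unfolding D_def of_int_sum sum_distrib_right by (rule sum.cong[OF refl]) (rule abd(2)[symmetric])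
  also have "\<dots> = Re (E - E)"
    unfolding E_def by (subst (2) cube[symmetric]) (simp add: sum_subtractf Re_sum)
  finally have D: "D = 0" by simp
  have "2 * E = (\<Sum>t\<in>I. oct (y t) + oct (y t) ^ 3)"
    unfolding sum.distrib cube E_def by simp
  also have "\<dots> = (\<Sum>t\<in>I. of_int (2 * a t) + of_int (b t) * (\<i> * sqrt 2))"
    by (rule sum.cong) (simp_all add: abd)
  also have "\<dots> = of_int (2 * A) + of_int B * (\<i> * sqrt 2)"
    unfolding A_def B_def sum.distrib by (simp add: sum_distrib_left sum_distrib_right)
  finally have E: "E = Complex (of_int A) (of_int B * sqrt 2 / 2)"
    by (simp add: complex_eq_iff)
  have "of_int P = Re (E * cnj E)" using norm unfolding E_def by simp
  also have "\<dots> = of_int A ^ 2 + of_int B ^ 2 / 2"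
    unfolding E by (simp add: power2_eq_square)
  finally have "real_of_int (2 * P) = real_of_int (2 * A ^ 2 + B ^ 2)" by simp
  then have PB: "2 * P = 2 * A ^ 2 + B ^ 2" by (simp only: of_int_eq_iff)
  then have "B ^ 2 = 2 * (P - A ^ 2)" by simp
  then have "even B" by (metis dvd_triv_left even_power)
  then obtain c where "B = 2 * c" by blast
  then have "P = A ^ 2 + 2 * c ^ 2" using PB by (simp add: power2_eq_square)
  moreover have "(\<Sum>t\<in>I. y t + y t ^ 7) \<approx> of_int (2 * A)"
  proof -
    have "(\<Sum>t\<in>I. y t + y t ^ 7) \<approx> (\<Sum>t\<in>I. of_int (2 * a t) + of_int (d t) * (\<omega> - \<omega> ^ 3))"
      by (rule eqv_sum) (rule abd)
    also have "(\<Sum>t\<in>I. of_int (2 * a t) + of_int (d t) * (\<omega> - \<omega> ^ 3)) = of_int (2 * A) + of_int D * (\<omega> - \<omega> ^ 3)"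
      unfolding A_def D_def sum.distrib by (simp add: sum_distrib_left sum_distrib_right)
    finally show ?thesis by (simp add: D)
  qed
  ultimately show ?thesis by blast
qed

end

section \<open>Primes congruent to 1 modulo 8\<close>

lemma zeta8_neq: "zeta8 \<noteq> 1" "zeta8 ^ 5 \<noteq> 1"
proof -
  show "zeta8 \<noteq> 1" using zeta8_pow4 by auto
  have "zeta8 ^ 5 = zeta8 ^ 4 * zeta8" by (simp flip: power_Suc2)
  then have "zeta8 ^ 5 = - zeta8" by (simp add: zeta8_pow4)
  moreover have "zeta8 \<noteq> - 1"
  proof
    assume "zeta8 = - 1"
    then have "zeta8 ^ 4 = (- 1) ^ 4" by (rule arg_cong)
    then show False using zeta8_pow4 by simp
  qed
  ultimately show "zeta8 ^ 5 \<noteq> 1" by (metis minus_equation_iff)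
qed

text \<open>The sum is the Jacobi sum \<open>E = (\<Sum>t. \<chi> t * \<phi> (1 + t))\<close> with \<open>\<chi> t\<close> the lift of \<open>t^n\<close> and \<open>\<phi> = \<chi>^4\<close> the
quadratic character. The substitution \<open>t \<mapsto> 1 / t\<close> turns \<open>\<chi>\<close> into \<open>\<chi>^3\<close>: it gives
\<open>\<chi>^{-1} (t) * \<phi> (t) * \<phi> (1 + t)\<close>, and \<open>\<phi> = \<chi>^4\<close>. In the congruence for \<open>2 * a\<close>, the power
\<open>t^n (1 + t)^{4n}\<close> has degree below \<open>p - 1\<close> and contributes nothing, while \<open>t^{7n} (1 + t)^{4n}\<close>, its inverse
at the units, contributes the coefficient of \<open>t^{8n}\<close>.\<close>

theorem split_norm_form:
  fixes p n :: nat
  assumes p: "prime p" and pn: "p = 8 * n + 1"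
  shows "\<exists>a b. int p = a ^ 2 + 2 * b ^ 2 \<and> [2 * a = - int ((4 * n) choose n)] (mod int p)"
proof -
  define P where "P = int p"
  have n: "n > 0" using p pn by (intro gr0I) simp
  have P: "prime P" using p by (simp add: P_def)
  have P1: "P > 1" using P prime_gt_1_int by blast
  have fermat: "[t ^ (8 * n) = 1] (mod P)" if "\<not> P dvd t" for t
    using fermat_int[OF p, of t] that by (simp add: P_def pn)
  have "\<not> (p - 1) dvd (4 * n)" using n by (auto simp: pn dest: dvd_imp_le)
  then obtain g where g: "\<not> P dvd g" "\<not> [g ^ (4 * n) = 1] (mod P)"
    using exists_power_not_cong_1[OF p] unfolding P_def by blast
  have "P dvd (g ^ (4 * n) - 1) * (g ^ (4 * n) + 1)"
    using fermat[OF g(1)] by (simp add: cong_iff_dvd_diff algebra_simps flip: power_add)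
  then have g4: "P dvd g ^ (4 * n) + 1"
    using g(2) P prime_dvd_mult_iff unfolding cong_iff_dvd_diff by blast
  interpret octic_root P "g ^ n"
  proof
    show "prime_elem P" using P by (rule prime_imp_prime_elem)
    show "\<not> P dvd 2" using n by (auto simp: P_def pn dest: zdvd_imp_le)
    show "P dvd (g ^ n) ^ 4 + 1" using g4 by (simp add: mult.commute flip: power_mult)
  qed
  have eqv_cong: "eqv x y \<longleftrightarrow> [x = y] (mod P)" for x y by (simp add: eqv_def cong_iff_dvd_diff)
  have octic_n: "octic (t ^ n)" for t
  proof (cases "P dvd t")
    case True
    then show ?thesis using n by (simp add: octic_def dvd_power_le[of P t 1, simplified])
  next
    case False
    then show ?thesis using fermat by (simp add: octic_def eqv_cong mult.commute flip: power_mult)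
  qed
  define \<chi> where "\<chi> t = oct (t ^ n)" for t
  have \<chi>_mult: "\<chi> (s * t) = \<chi> s * \<chi> t" for s t
    unfolding \<chi>_def power_mult_distrib by (rule oct_mult[OF octic_n octic_n])
  have \<chi>_cong: "\<chi> s = \<chi> t" if "[s = t] (mod P)" for s t
    unfolding \<chi>_def by (rule oct_cong[OF octic_n]) (simp add: eqv_cong cong_pow that)
  have \<chi>_mod: "\<chi> (t mod P) = \<chi> t" for t by (rule \<chi>_cong) (simp add: cong_def)
  have \<chi>_zero: "\<chi> t = 0" if "P dvd t" for t
    unfolding \<chi>_def using that n by (intro oct_zero) (simp add: dvd_power_le[of P t 1, simplified])
  have \<chi>_norm: "\<chi> t * cnj (\<chi> t) = 1" and \<chi>_8: "\<chi> t ^ 8 = 1" if "\<not> P dvd t" for t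
    using that octic_n P unfolding \<chi>_def by (auto intro!: oct_norm oct_pow8 dest: prime_dvd_power)
  have \<chi>_one: "\<chi> 1 = 1" by (simp add: \<chi>_def)
  have \<chi>_g: "\<chi> g = zeta8"
    unfolding \<chi>_def using oct_omega_pow[of "g ^ n" 1] by simp
  define \<phi> where "\<phi> t = \<chi> t ^ 4" for t
  have \<phi>_mult: "\<phi> (s * t) = \<phi> s * \<phi> t" for s t by (simp add: \<phi>_def \<chi>_mult power_mult_distrib)
  have \<phi>_cong: "\<phi> s = \<phi> t" if "[s = t] (mod P)" for s t unfolding \<phi>_def \<chi>_cong[OF that] ..
  have \<phi>_mod: "\<phi> (t mod P) = \<phi> t" for t by (simp add: \<phi>_def \<chi>_mod)
  have \<phi>_zero: "\<phi> t = 0" if "P dvd t" for t by (simp add: \<phi>_def \<chi>_zero that)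
  have \<phi>_sq: "\<phi> t ^ 2 = 1" if "\<not> P dvd t" for t
    using \<chi>_8[OF that] by (simp add: \<phi>_def flip: power_mult)
  have \<phi>_cases: "\<phi> t = 0 \<or> \<phi> t = 1 \<or> \<phi> t = - 1" for t
    using \<phi>_sq[of t] \<phi>_zero[of t] by (auto simp: power2_eq_1_iff)
  have \<phi>_cnj: "cnj (\<phi> t) = \<phi> t" and \<phi>_cube: "\<phi> t ^ 3 = \<phi> t" for t using \<phi>_cases[of t] by auto
  have \<phi>_one: "\<phi> 1 = 1" by (simp add: \<phi>_def \<chi>_one)
  have \<phi>_oct: "\<phi> t = oct (t ^ (4 * n))" for t
    unfolding \<phi>_def \<chi>_def by (simp add: oct_power[OF octic_n, symmetric] mult.commute flip: power_mult)
  have units: "\<not> P dvd t" if "t \<in> {1..<P}" for t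
    using that by (auto dest: zdvd_imp_le)
  have sum_units: "(\<Sum>t\<in>{0..<P}. f t) = f 0 + (\<Sum>t\<in>{1..<P}. f t)" for f :: "int \<Rightarrow> complex"
  proof -
    have "{0..<P} = insert 0 {1..<P}" using P1 by auto
    then show ?thesis by simp
  qed
  have sum_\<chi>: "(\<Sum>t\<in>{0..<P}. \<chi> t) = 0"
    by (rule sum_character_eq_0[OF P \<chi>_mod \<chi>_mult g(1)]) (simp add: \<chi>_g zeta8_neq)
  have sum_\<phi>: "(\<Sum>t\<in>{0..<P}. \<phi> t) = 0"
    by (rule sum_character_eq_0[OF P \<phi>_mod \<phi>_mult g(1)]) (simp add: \<phi>_def \<chi>_g zeta8_pow4)
  have sum_\<chi>\<phi>: "(\<Sum>t\<in>{0..<P}. \<chi> t * \<phi> t) = 0"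
    by (rule sum_character_eq_0[OF P _ _ g(1)])
       (simp_all add: \<chi>_mod \<phi>_mod \<chi>_mult \<phi>_mult, simp add: \<phi>_def \<chi>_g zeta8_neq flip: power_Suc)
  define iv where "iv t = t ^ (8 * n - 1)" for t :: int
  have iv: "[t * iv t = 1] (mod P)" if "\<not> P dvd t" for t
    using fermat[OF that] n by (simp add: iv_def flip: power_Suc)
  define y where "y t = t ^ n * (1 + t) ^ (4 * n)" for t :: int
  have octic_4n: "octic (t ^ (4 * n))" for t
    using octic_power[OF octic_n, of t 4] by (simp add: mult.commute flip: power_mult)
  have octic_y: "octic (y t)" for t unfolding y_def by (intro octic_mult octic_n octic_4n)
  have oct_y: "oct (y t) = \<chi> t * \<phi> (1 + t)" for t
    unfolding y_def \<phi>_oct \<chi>_def by (rule oct_mult[OF octic_n octic_4n])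
  define E where "E = (\<Sum>t\<in>{0..<P}. \<chi> t * \<phi> (1 + t))"
  have cube: "(\<Sum>t\<in>{0..<P}. oct (y t) ^ 3) = (\<Sum>t\<in>{0..<P}. oct (y t))"
  proof -
    define f where "f t = \<chi> t ^ 3 * \<phi> (1 + t)" for t
    have f_mod: "f (t mod P) = f t" for t
      unfolding f_def \<chi>_mod by (metis \<phi>_mod mod_add_right_eq)
    have "f (iv t) = \<chi> t * \<phi> (1 + t)" if "t \<in> {1..<P}" for t
    proof -
      have u: "\<chi> t * \<chi> (iv t) = 1"
        using \<chi>_cong[OF iv[OF units[OF that]]] by (simp add: \<chi>_mult \<chi>_one)
      have iu: "\<not> P dvd iv t" using u \<chi>_zero by auto
      have "\<phi> t * \<phi> (1 + iv t) = \<phi> (t + t * iv t)" by (simp add: \<phi>_mult[symmetric] algebra_simps)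
      also have "\<dots> = \<phi> (1 + t)"
        by (rule \<phi>_cong) (metis add.commute cong_add_lcancel iv[OF units[OF that]])
      finally have 1: "\<phi> t * \<phi> (1 + iv t) = \<phi> (1 + t)" .
      have "f (iv t) = (\<chi> t * \<chi> (iv t)) ^ 4 * f (iv t)" by (simp add: u)
      also have "\<dots> = \<chi> (iv t) ^ 7 * (\<phi> t * \<phi> (1 + iv t))"
        by (simp add: f_def \<phi>_def power_mult_distrib mult_ac flip: power_add)
      also have "\<dots> = \<chi> (iv t) ^ 8 * \<chi> t * \<phi> (1 + t)"
      proof -
        have "\<chi> (iv t) ^ 7 = (\<chi> t * \<chi> (iv t)) * \<chi> (iv t) ^ 7" by (simp add: u)
        also have "\<dots> = \<chi> (iv t) ^ 8 * \<chi> t"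
        proof -
          have "\<chi> (iv t) ^ 8 = \<chi> (iv t) * \<chi> (iv t) ^ 7" by (simp flip: power_Suc)
          then show ?thesis by (simp add: mult_ac)
        qed
        finally show ?thesis unfolding 1 by simp
      qed
      finally show ?thesis by (simp add: \<chi>_8[OF iu])
    qed
    then have "(\<Sum>t\<in>{1..<P}. \<chi> t * \<phi> (1 + t)) = (\<Sum>t\<in>{1..<P}. f (iv t))" by simp
    also have "\<dots> = (\<Sum>t\<in>{1..<P}. f t)" by (rule sum_inverse_mod[where f = f, OF P f_mod iv])
    finally show ?thesis
      unfolding oct_y power_mult_distrib \<phi>_cube sum_units f_def by (simp add: \<chi>_zero)
  qed
  have norm: "E * cnj E = of_int P"
  proof -
    \<comment> \<open>Put \<open>t = r * s\<close> in the double sum. The inner sum over \<open>s\<close> is \<open>- \<phi> r\<close> over all residues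
      unless \<open>r = 1\<close>; the correction \<open>-1\<close> removes \<open>s = 0\<close>.\<close>
    define T where "T r = (\<Sum>s\<in>{1..<P}. \<phi> (1 + s * r) * \<phi> (1 + s))" for r
    have inner: "cnj (\<chi> s * \<phi> (1 + s)) * E = (\<Sum>r\<in>{0..<P}. \<chi> r * (\<phi> (1 + s * r) * \<phi> (1 + s)))"
      if "s \<in> {1..<P}" for s
    proof -
      have "E = (\<Sum>r\<in>{0..<P}. \<chi> (s * r + 0) * \<phi> (1 + (s * r + 0)))"
        unfolding E_def
        by (rule sum_affine_mod[OF P _ units[OF that], symmetric, where f = "\<lambda>t. \<chi> t * \<phi> (1 + t)"])
           (metis \<chi>_mod \<phi>_mod mod_add_right_eq)
      then have "cnj (\<chi> s * \<phi> (1 + s)) * E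
          = (\<Sum>r\<in>{0..<P}. (\<chi> s * cnj (\<chi> s)) * (\<chi> r * (\<phi> (1 + s * r) * \<phi> (1 + s))))"
        by (simp add: sum_distrib_left \<chi>_mult \<phi>_cnj mult_ac)
      then show ?thesis by (simp add: \<chi>_norm[OF units[OF that]])
    qed
    have "E * cnj E = (\<Sum>s\<in>{0..<P}. cnj (\<chi> s * \<phi> (1 + s)) * E)"
      by (subst (2) E_def) (simp add: sum_distrib_left mult.commute)
    also have "\<dots> = (\<Sum>s\<in>{1..<P}. \<Sum>r\<in>{0..<P}. \<chi> r * (\<phi> (1 + s * r) * \<phi> (1 + s)))"
      unfolding sum_units[of "\<lambda>s. cnj (\<chi> s * \<phi> (1 + s)) * E"] using inner by (simp add: \<chi>_zero)
    also have "\<dots> = (\<Sum>r\<in>{0..<P}. \<chi> r * T r)"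
      unfolding T_def by (subst sum.swap) (simp add: sum_distrib_left)
    also have "\<dots> = (\<Sum>r\<in>{0..<P}. (if r = 1 then of_int P else 0) - \<chi> r * \<phi> r - \<chi> r)"
    proof (rule sum.cong[OF refl])
      fix r assume r: "r \<in> {0..<P}"
      have full: "T r = (\<Sum>s\<in>{0..<P}. \<phi> (1 + s * r) * \<phi> (1 + s)) - 1"
        unfolding T_def sum_units[of "\<lambda>s. \<phi> (1 + s * r) * \<phi> (1 + s)"] by (simp add: \<phi>_one)
      have shift: "(\<Sum>s\<in>{0..<P}. \<phi> (1 + s * r) * \<phi> (1 + s)) = (\<Sum>u\<in>{1..<P}. \<phi> (1 - r + u * r) * \<phi> u)"
      proof -
        define f where "f u = \<phi> (1 - r + u * r) * \<phi> u" for u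
        have "f (u mod P) = f u" for u
        proof -
          have "\<phi> (1 - r + (u mod P) * r) = \<phi> (1 - r + u * r)"
            by (intro \<phi>_cong cong_add cong_mult cong_refl) (simp add: cong_def)
          then show ?thesis by (simp add: f_def \<phi>_mod)
        qed
        from sum_affine_mod[where f = f, OF P this, of 1 1]
        have "(\<Sum>s\<in>{0..<P}. f (1 * s + 1)) = (\<Sum>u\<in>{0..<P}. f u)" using P1 by simp
        also have "\<dots> = (\<Sum>u\<in>{1..<P}. f u)" unfolding sum_units by (simp add: f_def \<phi>_zero)
        finally show ?thesis by (simp add: f_def algebra_simps)
      qed
      show "\<chi> r * T r = (if r = 1 then of_int P else 0) - \<chi> r * \<phi> r - \<chi> r"
      proof (cases "r = 1")
        case True
        have "(\<Sum>u\<in>{1..<P}. \<phi> (1 - r + u * r) * \<phi> u) = (\<Sum>u\<in>{1..<P}. 1)"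
          by (rule sum.cong) (use \<phi>_sq[OF units] True in \<open>auto simp: power2_eq_square\<close>)
        also have "\<dots> = of_int P - 1" using P1 by simp
        finally show ?thesis using True full shift by (simp add: \<chi>_one \<phi>_one)
      next
        case False
        have "\<phi> (1 - r + u * r) * \<phi> u = \<phi> ((1 - r) * iv u + r)" if "u \<in> {1..<P}" for u
        proof -
          have "\<phi> u * \<phi> ((1 - r) * iv u + r) = \<phi> ((1 - r) * (u * iv u) + u * r)"
            by (simp add: \<phi>_mult[symmetric] algebra_simps)
          also have "\<dots> = \<phi> ((1 - r) * 1 + u * r)"
            by (intro \<phi>_cong cong_add cong_scalar_left iv units that cong_refl)
          finally have "\<phi> u * (\<phi> (1 - r + u * r)) = \<phi> u ^ 2 * \<phi> ((1 - r) * iv u + r)"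
            by (simp add: power2_eq_square)
          then show ?thesis using \<phi>_sq[OF units[OF that]] by (simp add: mult.commute)
        qed
        then have "(\<Sum>u\<in>{1..<P}. \<phi> (1 - r + u * r) * \<phi> u) = (\<Sum>u\<in>{1..<P}. \<phi> ((1 - r) * iv u + r))"
          by simp
        also have "\<dots> = (\<Sum>v\<in>{1..<P}. \<phi> ((1 - r) * v + r))"
          by (rule sum_inverse_mod[where f = "\<lambda>v. \<phi> ((1 - r) * v + r)", OF P _ iv])
             (intro \<phi>_cong cong_add cong_mult cong_refl, simp add: cong_def)
        also have "\<dots> = (\<Sum>v\<in>{0..<P}. \<phi> ((1 - r) * v + r)) - \<phi> r"
          unfolding sum_units by simp
        also have "(\<Sum>v\<in>{0..<P}. \<phi> ((1 - r) * v + r)) = (\<Sum>v\<in>{0..<P}. \<phi> v)"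
        proof (rule sum_affine_mod[where f = \<phi>, OF P \<phi>_mod])
          show "\<not> P dvd 1 - r"
          proof
            assume "P dvd 1 - r"
            then have "[1 = r] (mod P)" by (simp add: cong_iff_dvd_diff)
            then show False using False r P1 by (simp add: cong_def)
          qed
        qed
        finally show ?thesis using False unfolding full shift sum_\<phi> by (simp add: algebra_simps)
      qed
    qed
    also have "\<dots> = of_int P"
      using P1 unfolding sum_subtractf sum_\<chi> sum_\<chi>\<phi> by (simp add: sum.delta)
    finally show ?thesis .
  qed
  obtain a b where ab: "P = a ^ 2 + 2 * b ^ 2" "eqv (\<Sum>t\<in>{0..<P}. y t + y t ^ 7) (of_int (2 * a))"
    using octic_sum_norm_form[of "{0..<P}" y P] octic_y cube norm unfolding E_def oct_y by auto
  have "[(\<Sum>t\<in>{0..<P}. y t + y t ^ 7)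
      = (\<Sum>t\<in>{0..<P}. t ^ n * (1 + t) ^ (4 * n) + t ^ (7 * n) * (1 + t) ^ (4 * n))] (mod P)"
  proof (rule cong_sum)
    fix t
    have "[(1 + t) ^ (28 * n) = (1 + t) ^ (4 * n)] (mod P)"
    proof (cases "P dvd 1 + t")
      case True
      then have "P dvd (1 + t) ^ k" if "k > 0" for k
        using that by (simp add: dvd_power_le[of P "1 + t" 1, simplified])
      then show ?thesis using n by (metis cong_0_iff cong_sym cong_trans nat_0_less_mult_iff zero_less_numeral)
    next
      case False
      have "(1 + t) ^ (28 * n) = ((1 + t) ^ (8 * n)) ^ 3 * (1 + t) ^ (4 * n)"
        by (simp flip: power_mult power_add)
      also have "[\<dots> = 1 ^ 3 * (1 + t) ^ (4 * n)] (mod P)"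
        by (intro cong_scalar_right cong_pow fermat False)
      finally show ?thesis by simp
    qed
    then have "[t ^ (7 * n) * (1 + t) ^ (28 * n) = t ^ (7 * n) * (1 + t) ^ (4 * n)] (mod P)"
      by (rule cong_scalar_left)
    moreover have "y t ^ 7 = t ^ (7 * n) * (1 + t) ^ (28 * n)"
      by (simp add: y_def power_mult_distrib mult.commute flip: power_mult)
    ultimately show "[y t + y t ^ 7 = t ^ n * (1 + t) ^ (4 * n) + t ^ (7 * n) * (1 + t) ^ (4 * n)] (mod P)"
      unfolding y_def by (metis cong_add cong_refl)
  qed
  also have "[(\<Sum>t\<in>{0..<P}. t ^ n * (1 + t) ^ (4 * n) + t ^ (7 * n) * (1 + t) ^ (4 * n))
      = - int ((4 * n) choose (p - 1 - n)) + - int ((4 * n) choose (p - 1 - 7 * n))] (mod P)"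
    unfolding sum.distrib P_def by (intro cong_add sum_power_times_shifted_power[OF p]) (use n pn in auto)
  also have "- int ((4 * n) choose (p - 1 - n)) + - int ((4 * n) choose (p - 1 - 7 * n)) = - int ((4 * n) choose n)"
    using n by (simp add: pn binomial_eq_0)
  finally have "[2 * a = - int ((4 * n) choose n)] (mod P)"
    using ab(2) unfolding eqv_cong of_int_eq_id id_apply by (metis cong_sym cong_trans)
  then show ?thesis using ab(1) unfolding P_def by blast
qed

section \<open>Gaussian integers\<close>

datatype gint = Gint (gre: int) (gim: int)

lemma gint_eq_iff: "z = w \<longleftrightarrow> gre z = gre w \<and> gim z = gim w"
  by (cases z; cases w) auto

instantiation gint :: comm_ring_1
begin
definition "0 = Gint 0 0"
definition "1 = Gint 1 0"
definition "z + w = Gint (gre z + gre w) (gim z + gim w)"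
definition "z - w = Gint (gre z - gre w) (gim z - gim w)"
definition "- z = Gint (- gre z) (- gim z)"
definition "z * w = Gint (gre z * gre w - gim z * gim w) (gre z * gim w + gim z * gre w)"
instance
  by standard
     (simp_all add: gint_eq_iff zero_gint_def one_gint_def plus_gint_def minus_gint_def
        uminus_gint_def times_gint_def algebra_simps)
end

lemma gint_simps [simp]:
  "gre 0 = 0" "gim 0 = 0" "gre 1 = 1" "gim 1 = 0"
  "gre (z + w) = gre z + gre w" "gim (z + w) = gim z + gim w"
  "gre (z - w) = gre z - gre w" "gim (z - w) = gim z - gim w"
  "gre (- z) = - gre z" "gim (- z) = - gim z"
  "gre (z * w) = gre z * gre w - gim z * gim w" "gim (z * w) = gre z * gim w + gim z * gre w"
  by (simp_all add: zero_gint_def one_gint_def plus_gint_def minus_gint_def uminus_gint_def times_gint_def)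

lemma gint_of_nat [simp]: "gre (of_nat k) = int k" "gim (of_nat k) = 0"
  by (induction k) simp_all

lemma gint_of_int [simp]: "gre (of_int a) = a" "gim (of_int a) = 0"
  by (cases a; simp)+

definition gi :: gint where "gi = Gint 0 1"

lemma gi_simps [simp]: "gre gi = 0" "gim gi = 1"
  by (simp_all add: gi_def)

definition gbar :: "gint \<Rightarrow> gint" where "gbar z = Gint (gre z) (- gim z)"

lemma gbar_simps [simp]: "gre (gbar z) = gre z" "gim (gbar z) = - gim z"
  by (simp_all add: gbar_def)

definition gnorm :: "gint \<Rightarrow> int" where "gnorm z = gre z ^ 2 + gim z ^ 2"

lemma gnorm_mult: "gnorm (z * w) = gnorm z * gnorm w"
  by (simp add: gnorm_def power2_eq_square algebra_simps)

lemma mult_gbar: "z * gbar z = of_int (gnorm z)"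
  by (simp add: gint_eq_iff gnorm_def power2_eq_square)

lemma gi_sq: "gi ^ 2 = - 1"
  by (simp add: gint_eq_iff power2_eq_square)

lemma gint_decompose: "z = of_int (gre z) + gi * of_int (gim z)"
  by (simp add: gint_eq_iff)

lemma of_int_dvd_gint_iff: "of_int k dvd z \<longleftrightarrow> k dvd gre z \<and> k dvd gim z"
proof
  assume "of_int k dvd z"
  then obtain w where "z = of_int k * w" by blast
  then show "k dvd gre z \<and> k dvd gim z" by simp
next
  assume "k dvd gre z \<and> k dvd gim z"
  then obtain a b where "gre z = k * a" "gim z = k * b" by blast
  then have "z = of_int k * Gint a b" by (simp add: gint_eq_iff)
  then show "of_int k dvd z" by simp
qed

lemma prime_dvd_add_power:
  fixes x y :: "'a::comm_ring_1"
  assumes p: "prime p"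
  shows "of_nat p dvd (x + y) ^ p - (x ^ p + y ^ p)"
proof -
  have p1: "p > 1" using p prime_gt_1_nat by blast
  have "(x + y) ^ p = (\<Sum>k\<le>p. of_nat (p choose k) * x ^ k * y ^ (p - k))" by (rule binomial_ring)
  also have "{..p} = insert 0 (insert p {0<..<p})" by auto
  also have "(\<Sum>k\<in>insert 0 (insert p {0<..<p}). of_nat (p choose k) * x ^ k * y ^ (p - k))
      = y ^ p + (x ^ p + (\<Sum>k\<in>{0<..<p}. of_nat (p choose k) * x ^ k * y ^ (p - k)))"
    using p1 by simp
  finally have "(x + y) ^ p - (x ^ p + y ^ p) = (\<Sum>k\<in>{0<..<p}. of_nat (p choose k) * x ^ k * y ^ (p - k))"
    by simp
  also have "of_nat p dvd \<dots>"
  proof (rule dvd_sum)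
    fix k assume "k \<in> {0<..<p}"
    then have "p dvd (p choose k)" using p by (intro dvd_choose_prime) auto
    then have "of_nat p dvd (of_nat (p choose k) :: 'a)" by (metis dvd_def of_nat_mult)
    then show "of_nat p dvd of_nat (p choose k) * x ^ k * y ^ (p - k)" by simp
  qed
  finally show ?thesis .
qed

text \<open>The binomial coefficient of \<open>-1 - a\<close> over \<open>j\<close>, with \<open>p - 1 - a\<close> in place of \<open>-1 - a\<close>.\<close>

lemma binomial_complement_cong:
  fixes p a j :: nat
  assumes p: "prime p" and "a < p" "j < p"
  shows "[int ((p - 1 - a) choose j) = (-1) ^ j * int ((a + j) choose j)] (mod int p)"
  using \<open>j < p\<close>
proof (induction j)
  case 0
  then show ?case by simp
next
  case (Suc j)
  have "int (Suc j) * int ((p - 1 - a) choose Suc j) = (int p - 1 - int a - int j) * int ((p - 1 - a) choose j)"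
    using binomial_step[of j "p - 1 - a"] \<open>a < p\<close> by (simp add: of_nat_diff)
  also have "[\<dots> = - (int a + int j + 1) * ((-1) ^ j * int ((a + j) choose j))] (mod int p)"
    using Suc by (intro cong_mult Suc.IH) (auto simp: cong_iff_dvd_diff)
  also have "- (int a + int j + 1) * ((-1) ^ j * int ((a + j) choose j))
      = int (Suc j) * ((-1) ^ Suc j * int ((a + Suc j) choose Suc j))"
  proof -
    have "int (Suc j) * int ((a + Suc j) choose Suc j) = (int a + int j + 1) * int ((a + j) choose j)"
      using arg_cong[OF Suc_times_binomial_eq[of "a + j" j], of int]
      by (simp only: of_nat_mult add_Suc_right) (simp add: algebra_simps)
    then show ?thesis by (metis (no_types, lifting) minus_mult_commute mult.left_commute mult_minus_left power_Suc mult_1)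
  qed
  finally show ?case using cong_cancel_Suc p Suc.prems by blast
qed

lemma prime_dvd_binomial_pred:
  fixes p k :: nat
  assumes p: "prime p" and k: "p \<le> k" "k < 2 * p - 1"
  shows "p dvd (k choose (p - 1))"
proof -
  have "fact (p - 1) * fact (k - (p - 1)) * (k choose (p - 1)) = fact k"
    using k by (intro binomial_fact_lemma) simp
  moreover have "p dvd fact k" using k p by (simp add: prime_dvd_fact_iff)
  moreover have "\<not> p dvd fact (p - 1)" "\<not> p dvd fact (k - (p - 1))"
    using k p prime_gt_0_nat[OF p] by (auto simp: prime_dvd_fact_iff)
  ultimately show ?thesis using p by (metis prime_dvd_mult_iff)
qed

text \<open>Let \<open>c\<close> be the least positive quadratic nonresidue. Then \<open>c - 1\<close> is a square, with root
\<open>(c - 1)^{(p + 1) / 4}\<close>. So \<open>1 + a * \<i>\<close> has a nonresidue as its norm, and its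
power with exponent \<open>(p^2 - 1) / 8\<close> is a primitive eighth root of unity modulo \<open>p\<close>.\<close>

lemma exists_square_before_nonresidue:
  fixes p n :: nat
  assumes p: "prime p" and pn: "p = 8 * n + 3"
  obtains a :: int where "[(1 + a ^ 2) ^ (4 * n + 1) = - 1] (mod int p)"
proof -
  define m where "m = 4 * n + 1"
  let ?Q = "\<lambda>c. c > 0 \<and> \<not> [int c ^ m = 1] (mod int p)"
  have "\<not> (p - 1) dvd m" by (auto simp: pn m_def dest: dvd_imp_le)
  then obtain g where g: "\<not> int p dvd g" "\<not> [g ^ m = 1] (mod int p)"
    using exists_power_not_cong_1[OF p] by blast
  define u where "u = nat (g mod int p)"
  have "int p > 0" using p prime_gt_0_nat by simp
  then have u: "int u = g mod int p" by (simp add: u_def)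
  have "int u \<noteq> 0" using g(1) u by (simp add: dvd_eq_mod_eq_0)
  moreover have "\<not> [int u ^ m = 1] (mod int p)" using g(2) u by (simp add: cong_def power_mod)
  ultimately have "?Q u" by simp
  define c where "c = (LEAST c. ?Q c)"
  have c: "?Q c" unfolding c_def by (rule LeastI[of ?Q, OF \<open>?Q u\<close>])
  have "c \<le> u" unfolding c_def by (rule Least_le[of ?Q, OF \<open>?Q u\<close>])
  also have "u < p" using u \<open>int p > 0\<close> by (metis of_nat_less_iff pos_mod_bound)
  finally have "\<not> int p dvd int c" using c by (auto dest: dvd_imp_le)
  then have "[int c ^ (p - 1) = 1] (mod int p)" by (rule fermat_int[OF p])
  then have "int p dvd (int c ^ m - 1) * (int c ^ m + 1)"
    by (simp add: cong_iff_dvd_diff algebra_simps pn m_def flip: power_add power_Suc power_Suc2)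
  then have cm: "[int c ^ m = - 1] (mod int p)"
    using c p unfolding cong_iff_dvd_diff by (simp add: prime_dvd_mult_iff)
  have "c \<noteq> 1" using c by auto
  then have c1: "c - 1 > 0" "c - 1 < c" using c by auto
  then have pred: "[int (c - 1) ^ m = 1] (mod int p)"
    using not_less_Least[of "c - 1" ?Q] unfolding c_def[symmetric] by blast
  define a where "a = int (c - 1) ^ (2 * n + 1)"
  have "a ^ 2 = int (c - 1) ^ m * int (c - 1)"
    unfolding a_def m_def power_mult[symmetric] power_Suc2[symmetric] by (rule arg_cong) simp
  also have "[\<dots> = 1 * int (c - 1)] (mod int p)" by (rule cong_scalar_right[OF pred])
  finally have "[1 + a ^ 2 = 1 + 1 * int (c - 1)] (mod int p)" by (simp add: cong_add_lcancel)
  also have "1 + 1 * int (c - 1) = int c" using c1 by simp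
  finally have "[(1 + a ^ 2) ^ m = int c ^ m] (mod int p)" by (rule cong_pow)
  then show ?thesis using that cm cong_trans unfolding m_def by blast
qed

section \<open>Primes congruent to 3 modulo 8\<close>

lemma dvd_sum_two_squares_3mod4:
  fixes p :: nat and a b :: int
  assumes p: "prime p" and p4: "p mod 4 = 3" and dvd: "int p dvd a ^ 2 + b ^ 2"
  shows "int p dvd a \<and> int p dvd b"
proof (rule ccontr)
  assume neg: "\<not> (int p dvd a \<and> int p dvd b)"
  have P: "prime (int p)" using p by simp
  define m where "m = (p - 1) div 2"
  have m: "p - 1 = 2 * m" "odd m" using p4 unfolding m_def by presburger+
  have "int p dvd a \<longleftrightarrow> int p dvd b"
  proof -
    have "int p dvd a ^ 2 \<longleftrightarrow> int p dvd b ^ 2" using dvd by (metis dvd_add_right_iff dvd_add_left_iff)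
    then show ?thesis using P by (simp add: prime_dvd_power_iff)
  qed
  then have ab: "\<not> int p dvd a" "\<not> int p dvd b" using neg by auto
  have "[a ^ 2 = - (b ^ 2)] (mod int p)" using dvd by (simp add: cong_iff_dvd_diff)
  from cong_pow[OF this, of m] have "[a ^ (p - 1) = - (b ^ (p - 1))] (mod int p)"
    using m by (simp add: power_mult)
  then have "[1 = - (b ^ (p - 1))] (mod int p)"
    using fermat_int[OF p ab(1)] cong_sym cong_trans by blast
  moreover have "[- (b ^ (p - 1)) = - 1] (mod int p)"
    using fermat_int[OF p ab(2)] cong_minus_minus_iff by blast
  ultimately have "[1 = - 1] (mod int p)" using cong_trans by blast
  then have "int p dvd 2" by (simp add: cong_iff_dvd_diff)
  then have "p dvd 2" by (metis int_dvd_int_iff of_nat_numeral)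
  then have "p \<le> 2" by (rule dvd_imp_le) simp
  then show False using p4 p by (cases "p = 2") (auto simp: prime_ge_2_nat dest: prime_ge_2_nat)
qed

definition gline :: "int \<Rightarrow> gint" where "gline t = Gint 1 t"

lemma gline_simps [simp]: "gre (gline t) = 1" "gim (gline t) = t"
  by (simp_all add: gline_def)

lemma gline_alt: "gline t = 1 + gi * of_int t"
  by (simp add: gint_eq_iff)

lemma gbar_gline: "gbar (gline t) = 2 - gline t"
proof -
  have "(2::gint) = of_nat 2" by simp
  then show ?thesis by (simp add: gint_eq_iff del: of_nat_numeral)
qed

lemma of_int_gint_dvd_iff: "(of_int a :: gint) dvd of_int b \<longleftrightarrow> a dvd b"
  by (simp add: of_int_dvd_gint_iff)

text \<open>Expanding in powers of \<open>t\<close> leaves \<open>k choose (p - 1)\<close>, times \<open>-\<i>^{p - 1} = 1\<close>. This binomial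
coefficient is divisible by \<open>p\<close> for \<open>p \<le> k < 2 * (p - 1)\<close>. Thus on the line a power sum in the coordinate
\<open>1 + t * \<i>\<close> behaves as one in \<open>t\<close>.\<close>

lemma sum_gline_powers:
  fixes p n k :: nat
  assumes p: "prime p" and pn: "p = 8 * n + 3" and k: "k < 2 * (p - 1)"
  shows "of_int (int p) dvd (\<Sum>t\<in>{0..<int p}. gline t ^ k) - (if k = p - 1 then 1 else 0)"
proof -
  define Q :: gint where "Q = of_int (int p)"
  have int_dvd: "Q dvd of_int x - of_int y" if "[x = y] (mod int p)" for x y
    using that unfolding Q_def cong_iff_dvd_diff of_int_diff[symmetric] of_int_gint_dvd_iff .
  have expand: "(\<Sum>t\<in>{0..<int p}. gline t ^ k)
      = (\<Sum>j\<le>k. of_nat (k choose j) * gi ^ j * of_int (\<Sum>t\<in>{0..<int p}. t ^ j))"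
  proof -
    have "(\<Sum>t\<in>{0..<int p}. gline t ^ k)
        = (\<Sum>t\<in>{0..<int p}. \<Sum>j\<le>k. of_nat (k choose j) * gi ^ j * of_int (t ^ j))"
      unfolding gline_alt add.commute[of 1]
      by (simp add: binomial_ring power_mult_distrib mult.assoc)
    also have "\<dots> = (\<Sum>j\<le>k. of_nat (k choose j) * gi ^ j * of_int (\<Sum>t\<in>{0..<int p}. t ^ j))"
      by (subst sum.swap) (simp add: sum_distrib_left)
    finally show ?thesis .
  qed
  have dvd: "(j > 0 \<and> (p - 1) dvd j) \<longleftrightarrow> j = p - 1" if "j \<le> k" for j
    using dvd_below_double[of j "p - 1"] k pn that by auto
  have "Q dvd (\<Sum>j\<le>k. of_nat (k choose j) * gi ^ j * of_int (\<Sum>t\<in>{0..<int p}. t ^ j)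
                  - of_nat (k choose j) * gi ^ j * of_int (if j = p - 1 then - 1 else 0))"
  proof (rule dvd_sum)
    fix j assume "j \<in> {..k}"
    then have "[(\<Sum>t\<in>{0..<int p}. t ^ j) = (if j = p - 1 then - 1 else 0)] (mod int p)"
      using sum_powers_mod_prime[OF p, of j] dvd[of j] by simp
    from dvd_mult[OF int_dvd[OF this], of "of_nat (k choose j) * gi ^ j"]
    show "Q dvd of_nat (k choose j) * gi ^ j * of_int (\<Sum>t\<in>{0..<int p}. t ^ j)
                  - of_nat (k choose j) * gi ^ j * of_int (if j = p - 1 then - 1 else 0)"
      by (simp only: right_diff_distrib)
  qed
  then have 1: "Q dvd (\<Sum>t\<in>{0..<int p}. gline t ^ k)
      - (\<Sum>j\<le>k. of_nat (k choose j) * gi ^ j * of_int (if j = p - 1 then - 1 else 0))"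
    by (simp only: expand sum_subtractf)
  have "(\<Sum>j\<le>k. of_nat (k choose j) * gi ^ j * of_int (if j = p - 1 then - 1 else 0))
      = (\<Sum>j\<le>k. if j = p - 1 then - (of_nat (k choose j) * gi ^ j) else 0)"
    by (rule sum.cong) auto
  also have "\<dots> = - (of_nat (k choose (p - 1)) * gi ^ (p - 1))" by (simp add: sum.delta binomial_eq_0)
  also have "gi ^ (p - 1) = - 1"
  proof -
    have "p - 1 = 2 * (4 * n + 1)" using pn by simp
    then have "gi ^ (p - 1) = (gi ^ 2) ^ (4 * n + 1)" by (simp only: power_mult)
    then show ?thesis by (simp add: gi_sq)
  qed
  finally have 2: "Q dvd (\<Sum>t\<in>{0..<int p}. gline t ^ k) - of_nat (k choose (p - 1))"
    using 1 by simp
  have "[int (k choose (p - 1)) = (if k = p - 1 then 1 else 0)] (mod int p)"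
  proof -
    consider "k < p - 1" | "k = p - 1" | "p \<le> k" by linarith
    then show ?thesis
    proof cases
      case 3
      then have "p dvd (k choose (p - 1))" using k by (intro prime_dvd_binomial_pred p) auto
      moreover have "k \<noteq> p - 1" using 3 prime_gt_0_nat[OF p] by linarith
      ultimately show ?thesis by (simp add: cong_0_iff)
    qed (simp_all add: binomial_eq_0)
  qed
  from dvd_add[OF 2 int_dvd[OF this]] show ?thesis
    unfolding Q_def by (cases "k = p - 1") simp_all
qed

text \<open>The conjugate of \<open>w = 1 + t * \<i>\<close> is \<open>2 - w\<close>, so the sum is the coefficient of \<open>w^{p - 1}\<close> in
\<open>w^e (2 - w)^f\<close>.\<close>

lemma sum_gline_gbar_powers:
  fixes p n e f :: nat
  assumes p: "prime p" and pn: "p = 8 * n + 3" and ef: "e \<le> p - 1" "e + f < 2 * (p - 1)"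
  shows "of_int (int p) dvd (\<Sum>t\<in>{0..<int p}. gline t ^ e * gbar (gline t) ^ f)
     - of_int (int (f choose (p - 1 - e)) * (- 1) ^ (p - 1 - e) * 2 ^ (f - (p - 1 - e)))"
proof -
  define Q :: gint where "Q = of_int (int p)"
  define c :: "nat \<Rightarrow> gint" where "c j = of_int (int (f choose j) * (- 1) ^ j * 2 ^ (f - j))" for j
  have "(\<Sum>t\<in>{0..<int p}. gline t ^ e * gbar (gline t) ^ f)
      = (\<Sum>t\<in>{0..<int p}. \<Sum>j\<le>f. c j * gline t ^ (e + j))"
  proof (rule sum.cong[OF refl])
    fix t
    have "gbar (gline t) ^ f = (\<Sum>j\<le>f. of_nat (f choose j) * (- gline t) ^ j * 2 ^ (f - j))"
      unfolding gbar_gline using binomial_ring[of "- gline t" 2 f] by simp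
    also have "\<dots> = (\<Sum>j\<le>f. c j * gline t ^ j)"
      by (rule sum.cong[OF refl]) (subst power_minus, simp add: c_def mult_ac)
    finally show "gline t ^ e * gbar (gline t) ^ f = (\<Sum>j\<le>f. c j * gline t ^ (e + j))"
      by (simp add: sum_distrib_left power_add mult_ac)
  qed
  also have "\<dots> = (\<Sum>j\<le>f. c j * (\<Sum>t\<in>{0..<int p}. gline t ^ (e + j)))"
    by (subst sum.swap) (simp add: sum_distrib_left)
  finally have eq: "(\<Sum>t\<in>{0..<int p}. gline t ^ e * gbar (gline t) ^ f) = \<dots>" .
  have "Q dvd (\<Sum>j\<le>f. c j * (\<Sum>t\<in>{0..<int p}. gline t ^ (e + j)) - c j * (if e + j = p - 1 then 1 else 0))"
  proof (rule dvd_sum)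
    fix j assume "j \<in> {..f}"
    then have "e + j < 2 * (p - 1)" using ef by simp
    from dvd_mult[OF sum_gline_powers[OF p pn this], of "c j"]
    show "Q dvd c j * (\<Sum>t\<in>{0..<int p}. gline t ^ (e + j)) - c j * (if e + j = p - 1 then 1 else 0)"
      unfolding Q_def by (simp only: right_diff_distrib)
  qed
  then have 1: "Q dvd (\<Sum>t\<in>{0..<int p}. gline t ^ e * gbar (gline t) ^ f)
      - (\<Sum>j\<le>f. c j * (if e + j = p - 1 then 1 else 0))"
    by (simp only: eq sum_subtractf)
  have "(\<Sum>j\<le>f. c j * (if e + j = p - 1 then 1 else 0)) = (\<Sum>j\<le>f. if j = p - 1 - e then c j else 0)"
    by (rule sum.cong) (use ef in auto)
  also have "\<dots> = c (p - 1 - e)" by (simp add: sum.delta c_def binomial_eq_0)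
  finally show ?thesis using 1 unfolding Q_def c_def by simp
qed

text \<open>The Gaussian integers modulo \<open>p\<close> form the field with \<open>p^2\<close> elements, \<open>\<chi>\<close> is the lift of
\<open>z \<mapsto> z^{(p^2 - 1) / 8}\<close>, and \<open>E\<close> is the sum of \<open>\<chi>\<close> over the line \<open>1 + t * \<i>\<close>. The Frobenius map is
complex conjugation and \<open>p \<equiv> 3 (mod 8)\<close>, so \<open>\<chi>\<close> at the conjugate of \<open>z\<close> is \<open>\<chi> (z)^3\<close>; on the line
conjugation is \<open>t \<mapsto> -t\<close>. The restriction \<open>\<sigma>\<close> of \<open>\<chi>\<close> to the prime field is the quadratic character.

For the norm of \<open>E\<close>, the product \<open>(1 + t * \<i>) (1 - s * \<i>)\<close> is \<open>1 + t * s\<close> times the point \<open>1 + r * \<i>\<close> with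
\<open>r = (t - s) / (1 + t * s)\<close>, the subtraction formula of the tangent. For fixed \<open>s\<close> this is a permutation of the
projective line with inverse \<open>r \<mapsto> (r + s) / (1 - r * s)\<close>, and in terms of \<open>r\<close> the sum over \<open>s\<close> is a linear
sum of \<open>\<sigma>\<close>, which vanishes unless \<open>r = 0\<close>.

For the trace, conjugation is used to write \<open>\<chi>\<close> and its inverse as \<open>w^{3n + 1}\<close> and \<open>w^{5n + 1}\<close> times the
conjugate of \<open>w\<close> to the powers \<open>n\<close> and \<open>7n + 2\<close>; the first has too small a degree to contribute.\<close>

theorem inert_norm_form:
  fixes p n :: nat
  assumes p: "prime p" and pn: "p = 8 * n + 3"
  shows "\<exists>a b. int p = a ^ 2 + 2 * b ^ 2 \<and> [4 * a ^ 2 = int ((4 * n + 1) choose n) ^ 2] (mod int p)"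
proof -
  define P where "P = int p"
  define Q :: gint where "Q = of_int P"
  have P: "prime P" using p by (simp add: P_def)
  have P1: "P > 1" using P prime_gt_1_int by blast
  have Q_dvd: "Q dvd z \<longleftrightarrow> P dvd gre z \<and> P dvd gim z" for z
    unfolding Q_def by (rule of_int_dvd_gint_iff)
  have Q_int: "Q dvd of_int a - of_int b \<longleftrightarrow> [a = b] (mod P)" for a b
    by (simp add: Q_dvd cong_iff_dvd_diff)
  have Q_norm: "Q dvd z \<longleftrightarrow> P dvd gnorm z" for z
  proof
    assume "P dvd gnorm z"
    moreover have "p mod 4 = 3" using pn by presburger
    ultimately show "Q dvd z" unfolding Q_dvd P_def gnorm_def
      using dvd_sum_two_squares_3mod4[OF p] by blast
  next
    assume "Q dvd z"
    then show "P dvd gnorm z" unfolding Q_dvd gnorm_def by (auto simp: power2_eq_square)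
  qed
  have Q_prime: "prime_elem Q"
  proof (rule prime_elemI)
    show "Q \<noteq> 0" using P1 by (simp add: Q_def gint_eq_iff)
    show "\<not> Q dvd 1" using P1 by (simp add: Q_dvd)
    show "Q dvd z \<or> Q dvd w" if "Q dvd z * w" for z w
      using that P unfolding Q_norm gnorm_mult by (simp add: prime_dvd_mult_iff)
  qed
  \<comment> \<open>\<open>e = (p^2 - 1) / 8\<close>, the exponent of the octic character\<close>
  define e where "e = (4 * n + 1) * (2 * n + 1)"
  have e8: "8 * e = (p + 1) * (p - 1)" and e4: "4 * e = (p + 1) * (4 * n + 1)"
    by (simp_all add: e_def pn algebra_simps)
  have gi_p: "gi ^ p = - gi"
  proof -
    have "p = Suc (2 * (4 * n + 1))" using pn by simp
    then have "gi ^ p = (gi ^ 2) ^ (4 * n + 1) * gi" by (simp only: power_Suc2 power_mult)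
    then show ?thesis by (simp add: gi_sq)
  qed
  have frob: "Q dvd z ^ p - gbar z" for z
  proof -
    have fer: "Q dvd of_int a ^ p - of_int a" for a
    proof (cases "P dvd a")
      case True
      then have "P dvd a ^ p - a" using pn by (simp add: dvd_power_le[of P a 1, simplified])
      then show ?thesis by (simp add: Q_int cong_iff_dvd_diff flip: of_int_power)
    next
      case False
      from cong_scalar_left[OF fermat_int[OF p False[unfolded P_def]], of a]
      moreover have "a * a ^ (p - 1) = a ^ p"
        using prime_gt_0_nat[OF p] by (simp flip: power_Suc)
      ultimately have "[a ^ p = a] (mod P)" by (simp add: P_def)
      then show ?thesis by (simp add: Q_int flip: of_int_power)
    qed
    let ?a = "of_int (gre z) :: gint" and ?b = "of_int (gim z) :: gint"
    have 1: "Q dvd (?a + gi * ?b) ^ p - (?a ^ p + (gi * ?b) ^ p)"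
      using prime_dvd_add_power[OF p, of ?a "gi * ?b"] by (simp add: Q_def P_def)
    have collect: "(?a + gi * ?b) ^ p - (?a ^ p + (gi * ?b) ^ p) + (?a ^ p - ?a) + (- gi) * (?b ^ p - ?b)
        = (?a + gi * ?b) ^ p - (?a - gi * ?b)"
      by (simp add: power_mult_distrib gi_p algebra_simps)
    have parts: "?a + gi * ?b = z" "?a - gi * ?b = gbar z"
      using gint_decompose[of z] by (simp_all add: gint_eq_iff)
    have "Q dvd (?a + gi * ?b) ^ p - (?a ^ p + (gi * ?b) ^ p) + (?a ^ p - ?a) + (- gi) * (?b ^ p - ?b)"
      by (intro dvd_add 1 fer dvd_mult)
    then show ?thesis unfolding collect unfolding parts .
  qed
  obtain a0 where a0: "[(1 + a0 ^ 2) ^ (4 * n + 1) = - 1] (mod P)"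
    using exists_square_before_nonresidue[OF p pn] unfolding P_def by blast
  have pow_diff: "Q dvd x ^ k - y ^ k" if "Q dvd x - y" for x y :: gint and k
  proof -
    have "x - y dvd x ^ k - y ^ k" by (simp add: power_diff_sumr2)
    then show ?thesis using that dvd_trans by blast
  qed
  have frob_norm: "Q dvd z ^ ((p + 1) * k) - of_int (gnorm z ^ k)" for z k
  proof -
    have "Q dvd z * (z ^ p - gbar z)" by (rule dvd_mult[OF frob])
    then have "Q dvd z ^ (p + 1) - of_int (gnorm z)" by (simp add: algebra_simps flip: mult_gbar)
    from pow_diff[OF this, of k] show ?thesis by (simp only: power_mult of_int_power)
  qed
  interpret octic_root Q "gline a0 ^ e"
  proof
    show "prime_elem Q" by (rule Q_prime)
    show "\<not> Q dvd 2"
    proof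
      assume "Q dvd 2"
      then have "Q dvd of_int 2 - of_int 0" by simp
      then have "P dvd 2" unfolding Q_int by (simp add: cong_0_iff)
      then show False using P1 pn by (auto simp: P_def dest: zdvd_imp_le)
    qed
    have "Q dvd gline a0 ^ ((p + 1) * (4 * n + 1)) - of_int ((1 + a0 ^ 2) ^ (4 * n + 1))"
    proof -
      have "gnorm (gline a0) = 1 + a0 ^ 2" by (simp add: gnorm_def)
      then show ?thesis using frob_norm[of "gline a0" "4 * n + 1"] by (simp only:)
    qed
    moreover have "Q dvd of_int ((1 + a0 ^ 2) ^ (4 * n + 1)) - of_int (- 1)"
      unfolding Q_int by (rule a0)
    ultimately have "Q dvd gline a0 ^ ((p + 1) * (4 * n + 1)) - of_int (- 1)"
      by (metis (no_types, lifting) diff_add_cancel add_diff_eq dvd_add)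
    moreover have "(gline a0 ^ e) ^ 4 = gline a0 ^ ((p + 1) * (4 * n + 1))"
      unfolding e4[symmetric] by (simp add: mult.commute flip: power_mult)
    ultimately show "Q dvd (gline a0 ^ e) ^ 4 + 1" by simp
  qed
  have eqv_of_int: "eqv (of_int a) (of_int b) \<longleftrightarrow> [a = b] (mod P)" for a b
    by (simp add: eqv_def Q_int)
  have octic_e: "octic (z ^ e)" for z
  proof (cases "Q dvd z")
    case True
    then show ?thesis by (simp add: octic_def e_def dvd_power_le[of Q z 1, simplified])
  next
    case False
    then have "\<not> P dvd gnorm z" by (simp add: Q_norm)
    then have "[gnorm z ^ (p - 1) = 1] (mod P)" using fermat_int[OF p] unfolding P_def by blast
    then have "eqv (of_int (gnorm z ^ (p - 1))) (of_int 1)" unfolding eqv_of_int .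
    moreover have "eqv (z ^ ((p + 1) * (p - 1))) (of_int (gnorm z ^ (p - 1)))"
      unfolding eqv_def by (rule frob_norm)
    ultimately have "eqv (z ^ (8 * e)) 1" unfolding e8 using eqv_trans by fastforce
    then show ?thesis by (simp add: octic_def mult.commute flip: power_mult)
  qed
  define \<chi> where "\<chi> z = oct (z ^ e)" for z
  have \<chi>_mult: "\<chi> (z * w) = \<chi> z * \<chi> w" for z w
    unfolding \<chi>_def power_mult_distrib by (rule oct_mult[OF octic_e octic_e])
  have \<chi>_cong: "\<chi> z = \<chi> w" if "eqv z w" for z w
    unfolding \<chi>_def by (rule oct_cong[OF octic_e]) (rule eqv_power[OF that])
  have \<chi>_zero: "\<chi> z = 0" if "Q dvd z" for z
    unfolding \<chi>_def using that by (intro oct_zero) (simp add: e_def dvd_power_le[of Q z 1, simplified])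
  have \<chi>_norm: "\<chi> z * cnj (\<chi> z) = 1" and \<chi>_8: "\<chi> z ^ 8 = 1" if "\<not> Q dvd z" for z
    using that octic_e prime_elem_dvd_power[OF Q_prime] unfolding \<chi>_def
    by (auto intro!: oct_norm oct_pow8)
  have \<chi>_one: "\<chi> 1 = 1" by (simp add: \<chi>_def)
  have \<chi>_bar: "\<chi> (gbar z) = \<chi> z ^ 3" if "\<not> Q dvd z" for z
  proof -
    have "\<chi> (gbar z) = \<chi> (z ^ p)" by (rule \<chi>_cong) (rule eqv_sym, simp add: eqv_def frob)
    also have "\<dots> = \<chi> z ^ p"
      unfolding \<chi>_def by (simp add: oct_power[OF octic_e, symmetric] mult.commute flip: power_mult)
    also have "\<dots> = (\<chi> z ^ 8) ^ n * \<chi> z ^ 3" by (simp add: pn flip: power_mult power_add)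
    finally show ?thesis by (simp add: \<chi>_8[OF that])
  qed
  define \<sigma> where "\<sigma> c = \<chi> (of_int c)" for c
  have \<sigma>_mult: "\<sigma> (c * d) = \<sigma> c * \<sigma> d" for c d by (simp add: \<sigma>_def \<chi>_mult)
  have \<sigma>_cong: "\<sigma> c = \<sigma> d" if "[c = d] (mod P)" for c d
    unfolding \<sigma>_def by (rule \<chi>_cong) (simp add: eqv_of_int that)
  have \<sigma>_mod: "\<sigma> (c mod P) = \<sigma> c" for c by (rule \<sigma>_cong) (simp add: cong_def)
  have \<sigma>_zero: "\<sigma> c = 0" if "P dvd c" for c unfolding \<sigma>_def by (rule \<chi>_zero) (simp add: Q_dvd that)
  have \<sigma>_one: "\<sigma> 1 = 1" by (simp add: \<sigma>_def \<chi>_one)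
  have \<sigma>_sq: "\<sigma> c * \<sigma> c = 1" if "\<not> P dvd c" for c
  proof -
    have "(c ^ e) ^ 2 = (c ^ (p - 1)) ^ (2 * n + 1)"
      unfolding power_mult[symmetric] by (rule arg_cong) (simp add: e_def pn)
    also have "[\<dots> = 1 ^ (2 * n + 1)] (mod P)"
      using fermat_int[OF p] that unfolding P_def by (intro cong_pow) blast
    finally have "eqv (of_int ((c ^ e) ^ 2)) (of_int 1)" by (simp only: eqv_of_int power_one)
    then have "eqv ((of_int c ^ e) ^ 2) 1" by (simp only: of_int_power of_int_1)
    then show ?thesis using octic_sign(2) unfolding \<sigma>_def \<chi>_def by fastforce
  qed
  have \<sigma>_neg_one: "\<sigma> (- 1) = - 1"
  proof -
    have "odd e" by (simp add: e_def)
    then have "(- 1 :: gint) ^ e = - 1" by simp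
    then show ?thesis by (simp add: \<sigma>_def \<chi>_def)
  qed
  have sum_\<sigma>: "(\<Sum>c\<in>{0..<P}. \<sigma> c) = 0"
    by (rule sum_character_eq_0[OF P \<sigma>_mod \<sigma>_mult, of "- 1"]) (use P1 in \<open>simp_all add: \<sigma>_neg_one\<close>)
  have line_unit: "\<not> Q dvd gline t" for t using P1 by (simp add: Q_dvd)
  have line_cong: "eqv (gline s) (gline t)" if "[s = t] (mod P)" for s t
    using that by (simp add: eqv_def Q_dvd cong_iff_dvd_diff)
  have line_mod: "\<chi> (gline (t mod P)) = \<chi> (gline t)" for t
    by (rule \<chi>_cong[OF line_cong]) (simp add: cong_def)
  have norm_unit: "\<not> P dvd 1 + s ^ 2" for s
    using line_unit[of s] unfolding Q_norm gnorm_def by simp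
  have cnj_\<chi>: "cnj (\<chi> (gline s)) = \<sigma> (1 + s ^ 2) * \<chi> (gline (- s))" for s
  proof -
    have "gline s * gline (- s) = of_int (1 + s ^ 2)"
      by (simp add: gint_eq_iff power2_eq_square)
    then have "\<sigma> (1 + s ^ 2) = \<chi> (gline s) * \<chi> (gline (- s))"
      unfolding \<sigma>_def by (metis \<chi>_mult)
    then have "\<sigma> (1 + s ^ 2) * \<chi> (gline (- s))  * (\<chi> (gline s) * cnj (\<chi> (gline s)))
        = (\<sigma> (1 + s ^ 2) * \<sigma> (1 + s ^ 2)) * cnj (\<chi> (gline s))" by simp
    then show ?thesis by (simp add: \<chi>_norm[OF line_unit] \<sigma>_sq[OF norm_unit])
  qed
  define E where "E = (\<Sum>t\<in>{0..<P}. \<chi> (gline t))"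
  have cube: "(\<Sum>t\<in>{0..<P}. \<chi> (gline t) ^ 3) = E"
  proof -
    have "\<chi> (gline t) ^ 3 = \<chi> (gline ((- 1) * t + 0))" for t
      using \<chi>_bar[OF line_unit[of t]] by (simp add: gbar_def gline_def)
    then have "(\<Sum>t\<in>{0..<P}. \<chi> (gline t) ^ 3) = (\<Sum>t\<in>{0..<P}. \<chi> (gline ((- 1) * t + 0)))" by simp
    also have "\<dots> = E" unfolding E_def
      by (rule sum_affine_mod[where f = "\<lambda>t. \<chi> (gline t)", OF P line_mod]) (use P1 in simp)
    finally show ?thesis .
  qed
  define iv where "iv t = t ^ (8 * n + 1)" for t :: int
  have iv: "[t * iv t = 1] (mod P)" if "\<not> P dvd t" for t
    using fermat_int[OF p, of t] that by (simp add: iv_def pn P_def flip: power_Suc)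
  define mob where "mob s t = (t - s) * iv (1 + t * s)" for s t
  have mob: "[(1 + t * s) * mob s t = t - s] (mod P)" if "\<not> P dvd 1 + t * s" for s t
    using cong_scalar_left[OF iv[OF that], of "t - s"] by (simp add: mob_def mult_ac)
  have mob_denom: "[(1 + t * s) * (1 - mob s t * s) = 1 + s ^ 2] (mod P)" if "\<not> P dvd 1 + t * s" for s t
  proof -
    have "(1 + t * s) * (1 - mob s t * s) = (1 + t * s) - (1 + t * s) * mob s t * s"
      by (simp add: algebra_simps)
    also have "[\<dots> = (1 + t * s) - (t - s) * s] (mod P)"
      by (intro cong_diff cong_refl cong_scalar_right mob that)
    also have "(1 + t * s) - (t - s) * s = 1 + s ^ 2" by (simp add: algebra_simps power2_eq_square)
    finally show ?thesis .
  qed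
  have mob_unit: "\<not> P dvd 1 + mob s t * (- s)" if "\<not> P dvd 1 + t * s" for s t
  proof
    assume "P dvd 1 + mob s t * (- s)"
    then have "P dvd (1 + t * s) * (1 - mob s t * s)" by simp
    then show False using mob_denom[OF that] norm_unit cong_dvd_iff by blast
  qed
  have mob_inverse: "[mob (- s) (mob s t) = t] (mod P)" if "\<not> P dvd 1 + t * s" for s t
  proof -
    define r where "r = mob s t"
    have u: "\<not> P dvd 1 + r * (- s)" using mob_unit[OF that] by (simp add: r_def)
    have "[(1 + t * s) * ((1 + r * (- s)) * mob (- s) r) = (1 + t * s) * (r + s)] (mod P)"
      using cong_scalar_left[OF mob[OF u]] by simp
    also have "(1 + t * s) * (r + s) = (1 + t * s) * r + (1 + t * s) * s" by (rule distrib_left)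
    also have "[\<dots> = (t - s) + (1 + t * s) * s] (mod P)"
      unfolding r_def by (intro cong_add mob that cong_refl)
    also have "(t - s) + (1 + t * s) * s = (1 + s ^ 2) * t" by (simp add: algebra_simps power2_eq_square)
    finally have "[((1 + t * s) * (1 - r * s)) * mob (- s) r = (1 + s ^ 2) * t] (mod P)"
      by (simp add: mult.assoc)
    moreover have "[((1 + t * s) * (1 - r * s)) * mob (- s) r = (1 + s ^ 2) * mob (- s) r] (mod P)"
      unfolding r_def by (rule cong_scalar_right[OF mob_denom[OF that]])
    ultimately have "[(1 + s ^ 2) * mob (- s) r = (1 + s ^ 2) * t] (mod P)"
      using cong_sym cong_trans by blast
    moreover have "coprime (1 + s ^ 2) P"
      using norm_unit[of s] P by (metis coprime_commute prime_imp_coprime)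
    ultimately show ?thesis unfolding r_def by (metis cong_mult_lcancel)
  qed
  have mob_mod: "[mob s (t mod P) = mob s t] (mod P)" for s t
    unfolding mob_def iv_def by (intro cong_mult cong_diff cong_pow cong_add cong_refl) (simp_all add: cong_def)
  \<comment> \<open>The last summand belongs to the parameter \<open>t = -1/s\<close>, which is sent to the point at infinity \<open>\<i>\<close>.\<close>
  have row: "(\<Sum>t\<in>{0..<P}. \<chi> (gline t * gline (- s)) * \<sigma> (1 + s ^ 2))
      = (\<Sum>r\<in>{0..<P}. \<sigma> (1 - r * s) * \<chi> (gline r)) + \<sigma> (- s) * \<chi> gi" for s
  proof -
    define A where "A = {t \<in> {0..<P}. \<not> P dvd 1 + t * s}"
    define B where "B = {r \<in> {0..<P}. \<not> P dvd 1 + r * (- s)}"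
    define f where "f r = \<sigma> (1 - r * s) * \<chi> (gline r)" for r
    have f_mod: "f (r mod P) = f r" for r
    proof -
      have "\<sigma> (1 - (r mod P) * s) = \<sigma> (1 - r * s)"
        by (intro \<sigma>_cong cong_diff cong_mult cong_refl) (simp add: cong_def)
      then show ?thesis by (simp add: f_def line_mod)
    qed
    have unit_mod: "P dvd 1 + (t mod P) * u \<longleftrightarrow> P dvd 1 + t * u" for t u
      by (intro cong_dvd_iff cong_add cong_mult cong_refl) (simp add: cong_def)
    have main: "\<chi> (gline t * gline (- s)) * \<sigma> (1 + s ^ 2) = f (mob s t)" if "t \<in> A" for t
    proof -
      have u: "\<not> P dvd 1 + t * s" using that by (simp add: A_def)
      have "eqv (gline t * gline (- s)) (of_int (1 + t * s) * gline (mob s t))"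
        using cong_sym[OF mob[OF u]] by (simp add: eqv_def Q_dvd cong_iff_dvd_diff)
      from \<chi>_cong[OF this] have 1: "\<chi> (gline t * gline (- s)) = \<sigma> (1 + t * s) * \<chi> (gline (mob s t))"
        unfolding \<sigma>_def \<chi>_mult .
      have "\<sigma> (1 + t * s) * \<sigma> (1 - mob s t * s) = \<sigma> (1 + s ^ 2)"
        using \<sigma>_cong[OF mob_denom[OF u]] by (simp only: \<sigma>_mult)
      then have "\<sigma> (1 + t * s) * \<sigma> (1 + s ^ 2) = (\<sigma> (1 + t * s) * \<sigma> (1 + t * s)) * \<sigma> (1 - mob s t * s)"
        by (simp only: mult.assoc)
      then have "\<sigma> (1 + t * s) * \<sigma> (1 + s ^ 2) = \<sigma> (1 - mob s t * s)"
        by (simp only: \<sigma>_sq[OF u] mult_1)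
      then show ?thesis unfolding 1 f_def by (metis mult.assoc mult.commute)
    qed
    have "(\<Sum>t\<in>A. \<chi> (gline t * gline (- s)) * \<sigma> (1 + s ^ 2)) = (\<Sum>t\<in>A. f (mob s t))"
      by (rule sum.cong[OF refl main])
    also have "\<dots> = sum f B"
    proof (rule sum_reindex_mod[where h = "mob (- s)" and P = P])
      show "f (r mod P) = f r" for r by (rule f_mod)
      show "mob s t mod P \<in> B" if "t \<in> A" for t
        using that mob_unit[of t s] P1 unfolding A_def B_def mem_Collect_eq unit_mod by simp
      show "mob (- s) r mod P \<in> A" if "r \<in> B" for r
        using that mob_unit[of r "- s"] P1 unfolding A_def B_def mem_Collect_eq unit_mod by simp
      show "mob (- s) (mob s t mod P) mod P = t" if "t \<in> A" for t
        using cong_trans[OF mob_mod mob_inverse, of t s] that by (simp add: A_def cong_def)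
      show "mob s (mob (- s) r mod P) mod P = r" if "r \<in> B" for r
        using cong_trans[OF mob_mod mob_inverse, of r "- s"] that by (simp add: B_def cong_def)
    qed
    also have "\<dots> = sum f {0..<P}"
      by (rule sum.mono_neutral_left) (auto simp: B_def f_def \<sigma>_zero)
    finally have affine: "(\<Sum>t\<in>A. \<chi> (gline t * gline (- s)) * \<sigma> (1 + s ^ 2)) = sum f {0..<P}" .
    have infinite: "(\<Sum>t\<in>{0..<P} - A. \<chi> (gline t * gline (- s)) * \<sigma> (1 + s ^ 2)) = \<sigma> (- s) * \<chi> gi"
    proof (cases "P dvd s")
      case True
      have "P dvd t * s" for t using True by simp
      then have empty: "{0..<P} - A = {}" using P1 unfolding A_def by (auto simp: dvd_add_left_iff)
      show ?thesis unfolding empty using True by (simp add: \<sigma>_zero)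
    next
      case False
      define t0 where "t0 = (- iv s) mod P"
      have "{0..<P} - A = {t0}"
      proof -
        have char: "P dvd 1 + t * s \<longleftrightarrow> [t = - iv s] (mod P)" for t
        proof
          assume "P dvd 1 + t * s"
          then have "[(1 + t * s) * iv s = 0] (mod P)" by (simp add: cong_0_iff)
          moreover have "[(1 + t * s) * iv s = iv s + t] (mod P)"
            using cong_add[OF cong_refl[of "iv s"] cong_scalar_left[OF iv[OF False], of t]]
            by (simp add: algebra_simps)
          ultimately have "[iv s + t = 0] (mod P)" using cong_sym cong_trans by blast
          then show "[t = - iv s] (mod P)" by (simp add: cong_iff_dvd_diff add.commute)
        next
          assume "[t = - iv s] (mod P)"
          then have "[1 + t * s = 1 + (- iv s) * s] (mod P)" by (intro cong_add cong_scalar_right cong_refl)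
          moreover have "P dvd 1 + (- iv s) * s"
            using cong_sym[OF iv[OF False]] by (simp add: cong_iff_dvd_diff mult.commute)
          ultimately show "P dvd 1 + t * s" using cong_dvd_iff by blast
        qed
        show ?thesis unfolding A_def char t0_def using P1 by (auto simp: cong_def)
      qed
      moreover have "P dvd 1 + t0 * s"
      proof -
        have "t0 \<in> {0..<P} - A" using calculation by simp
        then show ?thesis by (simp add: A_def)
      qed
      moreover have "\<chi> (gline t0 * gline (- s)) * \<sigma> (1 + s ^ 2) = \<sigma> (- s) * \<chi> gi"
        if t0: "P dvd 1 + t0 * s" for t0
      proof -
        have "eqv (gline t0 * gline (- s)) (of_int (t0 - s) * gi)"
          using t0 by (simp add: eqv_def Q_dvd)
        from \<chi>_cong[OF this] have 1: "\<chi> (gline t0 * gline (- s)) = \<sigma> (t0 - s) * \<chi> gi"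
          unfolding \<sigma>_def \<chi>_mult .
        have "s * (t0 - s) - (- 1) * (1 + s ^ 2) = 1 + t0 * s" by (simp add: algebra_simps power2_eq_square)
        then have "[s * (t0 - s) = (- 1) * (1 + s ^ 2)] (mod P)"
          using t0 unfolding cong_iff_dvd_diff by (simp only:)
        then have "\<sigma> s * \<sigma> (t0 - s) = \<sigma> (- 1) * \<sigma> (1 + s ^ 2)" using \<sigma>_cong \<sigma>_mult by metis
        then have "(\<sigma> s * \<sigma> s) * \<sigma> (t0 - s) * \<sigma> (1 + s ^ 2)
            = (\<sigma> (- 1) * \<sigma> s) * (\<sigma> (1 + s ^ 2) * \<sigma> (1 + s ^ 2))" by (simp add: mult_ac)
        then have "\<sigma> (t0 - s) * \<sigma> (1 + s ^ 2) = \<sigma> (- s)"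
          unfolding \<sigma>_sq[OF False] \<sigma>_sq[OF norm_unit] using \<sigma>_mult[of "- 1" s] by simp
        then show ?thesis unfolding 1 by (metis mult.assoc mult.commute)
      qed
      ultimately show ?thesis by simp
    qed
    have "A \<subseteq> {0..<P}" by (auto simp: A_def)
    then show ?thesis
      using affine infinite sum.subset_diff[of A "{0..<P}" "\<lambda>t. \<chi> (gline t * gline (- s)) * \<sigma> (1 + s ^ 2)"]
      by (simp add: f_def)
  qed
  have norm: "E * cnj E = of_int P"
  proof -
    have "E * cnj E = (\<Sum>s\<in>{0..<P}. \<Sum>t\<in>{0..<P}. \<chi> (gline t * gline (- s)) * \<sigma> (1 + s ^ 2))"
    proof -
      have "E * cnj E = (\<Sum>s\<in>{0..<P}. E * cnj (\<chi> (gline s)))"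
        by (subst (2) E_def) (simp add: sum_distrib_left)
      also have "\<dots> = (\<Sum>s\<in>{0..<P}. \<Sum>t\<in>{0..<P}. \<chi> (gline t * gline (- s)) * \<sigma> (1 + s ^ 2))"
        unfolding E_def sum_distrib_right cnj_\<chi> \<chi>_mult
        by (intro sum.cong refl) (simp only: ac_simps)
      finally show ?thesis .
    qed
    also have "\<dots> = (\<Sum>s\<in>{0..<P}. \<Sum>r\<in>{0..<P}. \<sigma> (1 - r * s) * \<chi> (gline r)) + (\<Sum>s\<in>{0..<P}. \<sigma> (- s)) * \<chi> gi"
      unfolding row by (simp add: sum.distrib sum_distrib_right)
    also have "(\<Sum>s\<in>{0..<P}. \<sigma> (- s)) = 0"
      using sum_\<sigma> \<sigma>_mult[of "- 1"] by (simp add: sum_distrib_left[symmetric] \<sigma>_neg_one sum_negf)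
    also have "(\<Sum>s\<in>{0..<P}. \<Sum>r\<in>{0..<P}. \<sigma> (1 - r * s) * \<chi> (gline r))
        = (\<Sum>r\<in>{0..<P}. (\<Sum>s\<in>{0..<P}. \<sigma> (1 - r * s)) * \<chi> (gline r))"
      by (subst sum.swap) (simp add: sum_distrib_right)
    also have "\<dots> = (\<Sum>r\<in>{0..<P}. if r = 0 then of_int P else 0)"
    proof (rule sum.cong[OF refl])
      fix r assume r: "r \<in> {0..<P}"
      show "(\<Sum>s\<in>{0..<P}. \<sigma> (1 - r * s)) * \<chi> (gline r) = (if r = 0 then of_int P else 0)"
      proof (cases "r = 0")
        case True
        have "gline 0 = 1" by (simp add: gint_eq_iff)
        then show ?thesis using True P1 by (simp add: \<sigma>_one \<chi>_one)
      next
        case False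
        then have "\<not> P dvd - r" using r by (auto dest: zdvd_imp_le)
        from sum_affine_mod[where f = \<sigma>, OF P \<sigma>_mod this, of 1]
        have "(\<Sum>s\<in>{0..<P}. \<sigma> (1 - r * s)) = 0" by (simp add: sum_\<sigma>)
        then show ?thesis using False by simp
      qed
    qed
    also have "\<dots> = of_int P" using P1 by (simp add: sum.delta)
    finally show ?thesis by simp
  qed
  obtain a b where ab: "P = a ^ 2 + 2 * b ^ 2"
      "eqv (\<Sum>t\<in>{0..<P}. gline t ^ e + (gline t ^ e) ^ 7) (of_int (2 * a))"
    using octic_sum_norm_form[of "{0..<P}" "\<lambda>t. gline t ^ e" P] octic_e cube norm
    unfolding E_def \<chi>_def by auto
  have red: "eqv (z ^ (k * p + l)) (z ^ l * gbar z ^ k)" for z k l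
  proof -
    have "z ^ (k * p + l) = z ^ l * (z ^ p) ^ k" by (simp add: power_add mult.commute flip: power_mult)
    moreover have "eqv (z ^ p) (gbar z)" by (simp add: eqv_def frob)
    ultimately show ?thesis by (metis eqv_mult eqv_power eqv_refl)
  qed
  have e_p: "e = n * p + (3 * n + 1)" "e * 7 = (7 * n + 2) * p + (5 * n + 1)"
    by (simp_all add: e_def pn algebra_simps)
  define c where "c = int ((7 * n + 2) choose (3 * n + 1)) * (- 1) ^ (3 * n + 1) * 2 ^ (4 * n + 1)"
  have reduce: "eqv (\<Sum>t\<in>{0..<P}. gline t ^ e + (gline t ^ e) ^ 7)
      (\<Sum>t\<in>{0..<P}. gline t ^ (3 * n + 1) * gbar (gline t) ^ n + gline t ^ (5 * n + 1) * gbar (gline t) ^ (7 * n + 2))"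
  proof (intro eqv_sum eqv_add)
    show "eqv (gline t ^ e) (gline t ^ (3 * n + 1) * gbar (gline t) ^ n)" for t
      unfolding e_p(1) by (rule red)
    show "eqv ((gline t ^ e) ^ 7) (gline t ^ (5 * n + 1) * gbar (gline t) ^ (7 * n + 2))" for t
      unfolding power_mult[symmetric] e_p(2) by (rule red)
  qed
  have evaluate: "eqv (\<Sum>t\<in>{0..<P}. gline t ^ (3 * n + 1) * gbar (gline t) ^ n + gline t ^ (5 * n + 1) * gbar (gline t) ^ (7 * n + 2))
      (of_int 0 + of_int c)"
    unfolding sum.distrib
  proof (rule eqv_add)
    have prem: "3 * n + 1 \<le> p - 1" "(3 * n + 1) + n < 2 * (p - 1)" using pn by simp_all
    have "int (n choose (p - 1 - (3 * n + 1))) = 0" using pn by (simp add: binomial_eq_0)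
    with sum_gline_gbar_powers[OF p pn prem]
    show "eqv (\<Sum>t\<in>{0..<P}. gline t ^ (3 * n + 1) * gbar (gline t) ^ n) (of_int 0)"
      unfolding eqv_def unfolding Q_def P_def by (simp only: mult_zero_left)
    have j: "p - 1 - (5 * n + 1) = 3 * n + 1" "7 * n + 2 - (3 * n + 1) = 4 * n + 1" using pn by simp_all
    have "5 * n + 1 \<le> p - 1" "(5 * n + 1) + (7 * n + 2) < 2 * (p - 1)" using pn by simp_all
    from sum_gline_gbar_powers[OF p pn this]
    show "eqv (\<Sum>t\<in>{0..<P}. gline t ^ (5 * n + 1) * gbar (gline t) ^ (7 * n + 2)) (of_int c)"
      unfolding j eqv_def c_def unfolding Q_def P_def .
  qed
  have "eqv (of_int (2 * a)) (of_int 0 + of_int c)"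
    by (rule eqv_trans[OF eqv_sym[OF ab(2)] eqv_trans[OF reduce evaluate]])
  then have "eqv (of_int (2 * a)) (of_int c)" by (simp only: of_int_0 add_0)
  then have "[2 * a = c] (mod P)" by (simp only: eqv_of_int power_one)
  then have "[(2 * a) ^ 2 = c ^ 2] (mod P)" by (rule cong_pow)
  moreover have "[c ^ 2 = int ((4 * n + 1) choose n) ^ 2] (mod P)"
  proof -
    have "\<not> P dvd 2" using P1 pn by (auto simp: P_def dest: zdvd_imp_le)
    then have two: "[2 ^ (p - 1) = 1] (mod P)" using fermat_int[OF p] unfolding P_def by blast
    have bin: "[int ((7 * n + 2) choose (3 * n + 1)) = (-1) ^ (3 * n + 1) * int ((4 * n + 1) choose n)] (mod P)"
    proof -
      have "p - 1 - n = 7 * n + 2" "n + (3 * n + 1) = 4 * n + 1" using pn by simp_all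
      moreover have "(4 * n + 1) choose (3 * n + 1) = (4 * n + 1) choose n"
        using binomial_symmetric[of n "4 * n + 1"] by simp
      ultimately show ?thesis
        using binomial_complement_cong[OF p, of n "3 * n + 1"] pn unfolding P_def by simp
    qed
    have "c ^ 2 = int ((7 * n + 2) choose (3 * n + 1)) ^ 2 * 2 ^ (p - 1)"
      by (simp add: c_def pn power_mult_distrib flip: power_mult)
    also have "[\<dots> = ((-1) ^ (3 * n + 1) * int ((4 * n + 1) choose n)) ^ 2 * 1] (mod P)"
      by (intro cong_mult cong_pow bin two)
    also have "((-1) ^ (3 * n + 1) * int ((4 * n + 1) choose n)) ^ 2 * 1 = int ((4 * n + 1) choose n) ^ 2"
      by (simp add: power_mult_distrib flip: power_mult)
    finally show ?thesis .
  qed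
  ultimately have "[4 * a ^ 2 = int ((4 * n + 1) choose n) ^ 2] (mod P)"
    using cong_trans by (fastforce simp: power_mult_distrib)
  then show ?thesis using ab(1) unfolding P_def by blast
qed

section \<open>Representations by the form and the congruence of rationals\<close>

text \<open>The product \<open>(a y - b x) (a y + b x)\<close> is a multiple of \<open>p\<close>, so \<open>p\<close> divides one factor. Composition of the
two representations writes \<open>p^2\<close> as \<open>c^2 + 2 d^2\<close> with this factor as \<open>d\<close>, and then \<open>d\<close> is too small to
be a nonzero multiple of \<open>p\<close>.\<close>

lemma norm_form_unique:
  fixes p a b x y :: int
  assumes p: "prime p" and ab: "p = a ^ 2 + 2 * b ^ 2" and xy: "p = x ^ 2 + 2 * y ^ 2"
  shows "x ^ 2 = a ^ 2"
proof -
  have pos: "p > 0" using p prime_gt_0_int by blast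
  have small: "d = 0" if "p dvd d" "c ^ 2 + 2 * d ^ 2 = p ^ 2" for c d
  proof (rule ccontr)
    assume "d \<noteq> 0"
    then have "p \<le> \<bar>d\<bar>" using that(1) pos by (metis dvd_abs_iff zdvd_imp_le zero_less_abs_iff)
    then have "p ^ 2 \<le> d ^ 2" using pos abs_le_square_iff[of p d] by simp
    moreover have "p ^ 2 > 0" "c ^ 2 \<ge> 0" using pos by simp_all
    ultimately show False using that(2) by linarith
  qed
  have square: "p ^ 2 = (a ^ 2 + 2 * b ^ 2) * (x ^ 2 + 2 * y ^ 2)"
    using arg_cong2[OF ab xy, of "(*)"] by (simp only: power2_eq_square)
  have expand: "(a * x + 2 * b * y) ^ 2 + 2 * (a * y - b * x) ^ 2 = p ^ 2"
    unfolding square by (simp add: power2_eq_square algebra_simps)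
  have expand': "(a * x - 2 * b * y) ^ 2 + 2 * (a * y + b * x) ^ 2 = p ^ 2"
    unfolding square by (simp add: power2_eq_square algebra_simps)
  have diff: "(a * y - b * x) * (a * y + b * x) = p * (y ^ 2 - b ^ 2)"
  proof -
    have "(a * y - b * x) * (a * y + b * x) = a ^ 2 * y ^ 2 - b ^ 2 * x ^ 2"
      by (simp add: power2_eq_square algebra_simps)
    moreover have "a ^ 2 = p - 2 * b ^ 2" "x ^ 2 = p - 2 * y ^ 2" using ab xy by simp_all
    ultimately have "(a * y - b * x) * (a * y + b * x) = (p - 2 * b ^ 2) * y ^ 2 - b ^ 2 * (p - 2 * y ^ 2)"
      by (simp only:)
    then show ?thesis by (simp add: algebra_simps)
  qed
  then have "p dvd (a * y - b * x) * (a * y + b * x)" by simp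
  then have "p dvd a * y - b * x \<or> p dvd a * y + b * x" using p by (simp only: prime_dvd_mult_iff)
  then have "a * y - b * x = 0 \<or> a * y + b * x = 0"
    using small[OF _ expand] small[OF _ expand'] by (elim disjE) simp_all
  then have "p * (y ^ 2 - b ^ 2) = 0" using diff by auto
  then have "y ^ 2 = b ^ 2" using pos by simp
  then show ?thesis using ab xy by linarith
qed

lemma p_integral_fraction:
  fixes u d :: int
  assumes "\<not> int p dvd d"
  shows "of_int u / of_int d \<in> p_integral_rats p"
proof -
  define r :: rat where "r = of_int u / of_int d"
  obtain n k where q: "quotient_of r = (n, k)" by (cases "quotient_of r")
  have k: "k > 0" "coprime n k" "r = of_int n / of_int k"
    using q quotient_of_denom_pos quotient_of_coprime quotient_of_div by blast+
  have "d \<noteq> 0" using assms by auto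
  then have "of_int u * of_int k = (of_int n * of_int d :: rat)"
    using k r_def by (simp add: field_simps)
  then have "u * k = n * d" by (metis of_int_eq_iff of_int_mult)
  then have "k dvd n * d" by (metis dvd_triv_right)
  then have "k dvd d" using k(2) by (simp add: coprime_commute coprime_dvd_mult_right_iff)
  then have "\<not> int p dvd k" using assms dvd_trans by blast
  then show ?thesis unfolding r_def[symmetric] p_integral_rats_def using q by simp
qed

lemma rat_cong_fraction:
  fixes u d z :: int
  assumes p: "prime p" and d: "\<not> int p dvd d" and cong: "[u = d * z] (mod int p)"
  shows "rat_cong p (of_int u / of_int d) (of_int z)"
proof -
  have d0: "d \<noteq> 0" using d by auto
  obtain w where w: "u - d * z = int p * w" using cong by (auto simp: cong_iff_dvd_diff)
  have "of_int u / of_int d - of_int z = (of_int (u - d * z) / of_int d :: rat)"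
    using d0 by (simp add: field_simps)
  also have "\<dots> = of_nat p * (of_int w / of_int d)" by (simp add: w)
  finally have "of_int u / of_int d - of_int z = of_nat p * (of_int w / of_int d :: rat)" .
  moreover have "(of_int z :: rat) \<in> p_integral_rats p"
    using p_integral_fraction[of p 1 z] p prime_gt_1_nat[OF p] by simp
  ultimately show ?thesis
    unfolding rat_cong_def using p_integral_fraction[OF d] by blast
qed

lemma rat_cong_quarter_sum:
  fixes p :: nat and h z :: int
  assumes p: "prime p" and h: "[4 * h = 1] (mod int p)"
    and cong: "[(\<Sum>k = 0..p - 1. int ((2 * k) choose k) * int (a_seq k) * h ^ k) = z] (mod int p)"
  shows "rat_cong p (\<Sum>k = 0..p - 1. of_nat ((2 * k) choose k) * (of_nat (a_seq k) / 4 ^ k)) (of_int z)"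
proof -
  define d :: int where "d = 4 ^ (p - 1)"
  define u where "u = (\<Sum>k = 0..p - 1. int ((2 * k) choose k) * int (a_seq k) * 4 ^ (p - 1 - k))"
  have P: "prime (int p)" using p by simp
  have "\<not> int p dvd 4"
  proof
    assume "int p dvd 4"
    then have "int p dvd 4 * h" by simp
    then have "int p dvd 1" using h cong_dvd_iff by blast
    then show False using P not_prime_unit by blast
  qed
  then have d: "\<not> int p dvd d" unfolding d_def using P prime_dvd_power by blast
  have "[u = d * (\<Sum>k = 0..p - 1. int ((2 * k) choose k) * int (a_seq k) * h ^ k)] (mod int p)"
    unfolding u_def sum_distrib_left
  proof (rule cong_sum)
    fix k assume "k \<in> {0..p - 1}"
    then have "d = 4 ^ (p - 1 - k) * 4 ^ k" unfolding d_def power_add[symmetric] by simp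
    then have "d * h ^ k = 4 ^ (p - 1 - k) * (4 * h) ^ k" by (simp only: power_mult_distrib mult.assoc)
    also have "[\<dots> = 4 ^ (p - 1 - k) * 1 ^ k] (mod int p)" by (intro cong_scalar_left cong_pow h)
    finally have "[4 ^ (p - 1 - k) = d * h ^ k] (mod int p)" by (simp add: cong_sym)
    from cong_scalar_left[OF this, of "int ((2 * k) choose k) * int (a_seq k)"]
    show "[int ((2 * k) choose k) * int (a_seq k) * 4 ^ (p - 1 - k)
        = d * (int ((2 * k) choose k) * int (a_seq k) * h ^ k)] (mod int p)"
      by (simp only: ac_simps)
  qed
  then have "[u = d * z] (mod int p)" using cong_trans cong_scalar_left[OF cong] by blast
  from rat_cong_fraction[OF p d this]
  have "rat_cong p (of_int u / of_int d) (of_int z)" .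
  moreover have "(\<Sum>k = 0..p - 1. of_nat ((2 * k) choose k) * (of_nat (a_seq k) / 4 ^ k)) = (of_int u / of_int d :: rat)"
    unfolding u_def of_int_sum sum_divide_distrib
  proof (rule sum.cong[OF refl])
    fix k assume "k \<in> {0..p - 1}"
    then have "d = 4 ^ (p - 1 - k) * 4 ^ k" unfolding d_def power_add[symmetric] by simp
    then show "of_nat ((2 * k) choose k) * (of_nat (a_seq k) / 4 ^ k)
        = (of_int (int ((2 * k) choose k) * int (a_seq k) * 4 ^ (p - 1 - k)) / of_int d :: rat)"
      by simp
  qed
  ultimately show ?thesis by simp
qed

lemma norm_form_binomial_square:
  fixes p m :: nat
  assumes p: "prime p" and m: "p = 2 * m + 1" and p8: "p mod 8 = 1 \<or> p mod 8 = 3"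
  shows "\<exists>a b. int p = a ^ 2 + 2 * b ^ 2 \<and> [4 * a ^ 2 = int (m choose (p div 8)) ^ 2] (mod int p)"
  using p8
proof
  assume "p mod 8 = 1"
  then obtain n where n: "p = 8 * n + 1" "p div 8 = n" by (metis div_mult_mod_eq mult.commute)
  then have "m = 4 * n" using m by simp
  obtain a b where ab: "int p = a ^ 2 + 2 * b ^ 2" "[2 * a = - int (m choose n)] (mod int p)"
    using split_norm_form[OF p n(1)] \<open>m = 4 * n\<close> by blast
  from cong_pow[OF ab(2), of 2] show ?thesis using ab(1) n by (auto simp: power_mult_distrib)
next
  assume "p mod 8 = 3"
  then obtain n where n: "p = 8 * n + 3" "p div 8 = n" by (metis div_mult_mod_eq mult.commute)
  then have "m = 4 * n + 1" using m by simp
  then show ?thesis using inert_norm_form[OF p n(1)] n(2) by simp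
qed

theorem theorem2p14:
  fixes p :: nat
  assumes "prime p" and "odd p"
  shows "([p = 1] (mod 8) \<or> [p = 3] (mod 8) \<longrightarrow>
            (\<exists>x y :: int. int p = x^2 + 2 * y^2) \<and>
            (\<forall>x y :: int. int p = x^2 + 2 * y^2 \<longrightarrow>
               rat_cong p
                 (\<Sum>k = 0..p - 1. of_nat ((2 * k) choose k) * (of_nat (a_seq k) / 4 ^ k))
                 (of_int (4 * x^2)))) \<and>
         ([p = 5] (mod 8) \<or> [p = 7] (mod 8) \<longrightarrow>
            rat_cong p
              (\<Sum>k = 0..p - 1. of_nat ((2 * k) choose k) * (of_nat (a_seq k) / 4 ^ k))
              0)"
proof (intro conjI impI)
  note p = \<open>prime p\<close>
  obtain m where m: "p = 2 * m + 1" using \<open>odd p\<close> oddE by blast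
  have "coprime 4 (int p)"
  proof -
    have "coprime (2 ^ 2) (int p)" using \<open>odd p\<close> by (simp only: coprime_power_left_iff) simp
    then show ?thesis by simp
  qed
  then obtain h where h: "[4 * h = 1] (mod int p)" using cong_solve_coprime_int by blast
  note closed_form = sum_cong_binomial_square[OF p m h]
  {
    assume "[p = 1] (mod 8) \<or> [p = 3] (mod 8)"
    then have p8: "p mod 8 = 1 \<or> p mod 8 = 3" by (simp add: cong_def)
    then have "even (p div 4)" by presburger
    obtain a b where ab: "int p = a ^ 2 + 2 * b ^ 2" "[4 * a ^ 2 = int (m choose (p div 8)) ^ 2] (mod int p)"
      using norm_form_binomial_square[OF p m p8] by blast
    show "\<exists>x y :: int. int p = x^2 + 2 * y^2" using ab(1) by blast
    show "\<forall>x y :: int. int p = x^2 + 2 * y^2 \<longrightarrow>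
        rat_cong p (\<Sum>k = 0..p - 1. of_nat ((2 * k) choose k) * (of_nat (a_seq k) / 4 ^ k)) (of_int (4 * x^2))"
    proof (intro allI impI)
      fix x y :: int
      assume xy: "int p = x^2 + 2 * y^2"
      have "prime (int p)" using p by simp
      then have "x ^ 2 = a ^ 2" by (rule norm_form_unique[OF _ ab(1) xy])
      then have "[(\<Sum>k = 0..p - 1. int ((2 * k) choose k) * int (a_seq k) * h ^ k) = 4 * x ^ 2] (mod int p)"
        using cong_trans[OF closed_form[unfolded if_P[OF \<open>even (p div 4)\<close>]] cong_sym[OF ab(2)]] by (simp only:)
      then show "rat_cong p (\<Sum>k = 0..p - 1. of_nat ((2 * k) choose k) * (of_nat (a_seq k) / 4 ^ k)) (of_int (4 * x^2))"
        by (rule rat_cong_quarter_sum[OF p h])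
    qed
  next
    assume "[p = 5] (mod 8) \<or> [p = 7] (mod 8)"
    then have "p mod 8 = 5 \<or> p mod 8 = 7" by (simp add: cong_def)
    then have "odd (p div 4)" by presburger
    then have "[(\<Sum>k = 0..p - 1. int ((2 * k) choose k) * int (a_seq k) * h ^ k) = 0] (mod int p)"
      using closed_form by simp
    from rat_cong_quarter_sum[OF p h this]
    show "rat_cong p (\<Sum>k = 0..p - 1. of_nat ((2 * k) choose k) * (of_nat (a_seq k) / 4 ^ k)) 0"
      by simp
  }
qed

end
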